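(* Let $F:\bar{\mathcal C}\to\mathcal C$ be a full additive functor between linear categories with $\mathrm{Ker}(F)^2=0$. Let $(C^\cdot,d)$ be a cochain complex in $\mathcal C$ with a fixed graded lift $\bar C^\cdot$ of $C^\cdot$ along $F$. Let $\mathbf C^\cdot$ be the cochain complex with $\mathbf C^n=\{h\in\mathrm{Hom}^n(\bar C^\cdot,\bar C^\cdot): F(h)=0\}$ and differential $\bar\delta=\delta_{\bar d,\bar d}$, for an arbitrary graded lift $\bar d$ of $d$. Put $L(d)=L_F(d\,|\,\bar C^\cdot)$. (1) There is an obstruction $o(d)=[\bar d^2]\in H^2\mathbf C$ (with $\bar d$ a graded lift of $d$ relative to $\bar C^\cdot$) such that $o(d)=0$ if and only if $L(d)\neq\varnothing$. (2) If $o(d)=0$, the map $v:|L(d)|^2\to H^1\mathbf C$, $(\bar d,\bar d')\mapsto[\bar d'-\bar d]$ satisfies $v(\bar d,\bar d')=0$ if and only if $[\bar d]=[\bar d']\in\mathrm{Sk}(L(d))$, and it induces an $H^1\mathbf C$-affine structure on $\mathrm{Sk}(L(d))$. (3) If $v(\bar d,\bar d')=0$, the map $w:L(d)(\bar d,\bar d')^2\to H^0\mathbf C$, $(\bar 1,\bar 1')\mapsto[\bar 1'-\bar 1]$ satisfies $w(\bar 1,\bar 1')=0$ if and only if $[\bar 1]=[\bar 1']\in\mathrm{Sk}(L(d)(\bar d,\bar d'))$, and it induces an $H^0\mathbf C$-affine structure on $\mathrm{Sk}(L(d)(\bar d,\bar d'))$.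
   Context: A linear category is a category enriched over the modules over some commutative ring. $\mathrm{Ker}(F)^2=0$ means: $gf=0$ for all composable morphisms $f,g$ of $\bar{\mathcal C}$ with $F(f)=0=F(g)$. Graded objects are families $C^\cdot=(C^i)_{i\in\mathbb Z}$; $\mathrm{Hom}^n(C^\cdot,D^\cdot)=\prod_i\mathcal C(C^i,D^{i+n})$ is the group of graded maps of degree $n$. A differential on $C^\cdot$ is $d\in\mathrm{Hom}^1(C^\cdot,C^\cdot)$ with $d^2=0$. For $d_C\in\mathrm{Hom}^1(C^\cdot,C^\cdot)$ and $d_D\in\mathrm{Hom}^1(D^\cdot,D^\cdot)$, put $\delta_{d_C,d_D}(f)=d_Df-(-1)^nfd_C$ for $f\in\mathrm{Hom}^n(C^\cdot,D^\cdot)$. A graded lift of $C^\cdot$ is a graded object $\bar C^\cdot$ of $\bar{\mathcal C}$ with an isomorphism $c:C^\cdot\cong F(\bar C^\cdot)$ of graded objects. A graded lift of a graded map $f$ between graded objects with graded lifts $c,c'$ is a graded map $\bar f$ of the same degree between the lifted objects with $F(\bar f)c=c'f$. The restriction of $\delta_{\bar d,\bar d}$ to $\mathbf C^\cdot$ does not depend on the chosen graded lift $\bar d$ of $d$, and it squares to zero. $L_F(d\,|\,\bar C^\cdot)$ is the following bigroupoid. Objects (the set of which is $|L(d)|$): graded lifts $\bar d$ of $d$ on $\bar C^\cdot$ with $\bar d^2=0$. 1-cells $\bar d\to\bar d'$: graded lifts $\bar 1:\bar C^\cdot\to\bar C^\cdot$ of $1:C^\cdot\to C^\cdot$ with $\bar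 d'\,\bar 1=\bar 1\,\bar d$ that are isomorphisms of complexes. 2-cells $\bar 1\to\bar 1'$: graded maps $h$ of degree $-1$ with $F(h)=0$ and $\delta_{\bar d,\bar d'}(h)=\bar 1'-\bar 1$. $L(d)(\bar d,\bar d')$ is the groupoid of 1-cells and 2-cells from $\bar d$ to $\bar d'$. $\mathrm{Sk}(L(d))$ is the set of classes of objects, two objects being identified if there is a 1-cell between them; $\mathrm{Sk}$ of a groupoid is its set of isomorphism classes of objects. An $A$-affine structure on a set ($A$ an abelian group) is a simply transitive action of $A$; the map "induces" it as its difference map. *)

theory Defs
  imports "HOL-Algebra.Product_Groups" "HOL-Algebra.Group_Action" "HOL-Algebra.Module"
begin

section \<open>Linear categories and additive functors\<close>

text \<open>
  A linear category is given in enriched form: each pair of objects has a module of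
  morphisms. These modules may overlap as sets, so composition takes its three objects as
  arguments: \<open>cmp C X Y Z g f\<close> is the composite of \<open>f : X \<rightarrow> Y\<close> and \<open>g : Y \<rightarrow> Z\<close>. Only the module
  part of the records \<open>Hom C X Y\<close> is used; their fields \<open>mult\<close> and \<open>one\<close> are irrelevant.
\<close>

record ('o, 'r, 'm) lincat =
  Ob :: "'o set"
  Hom :: "'o \<Rightarrow> 'o \<Rightarrow> ('r, 'm) module"
  ident :: "'o \<Rightarrow> 'm"
  cmp :: "'o \<Rightarrow> 'o \<Rightarrow> 'o \<Rightarrow> 'm \<Rightarrow> 'm \<Rightarrow> 'm"

locale linear_category =
  fixes R :: "'r ring" and C :: "('o, 'r, 'm) lincat"
  assumes base_ring: "cring R"
    and hom_module: "\<lbrakk>X \<in> Ob C; Y \<in> Ob C\<rbrakk> \<Longrightarrow> module R (Hom C X Y)"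
    and ident_closed: "X \<in> Ob C \<Longrightarrow> ident C X \<in> carrier (Hom C X X)"
    and cmp_closed:
      "\<lbrakk>X \<in> Ob C; Y \<in> Ob C; Z \<in> Ob C; f \<in> carrier (Hom C X Y); g \<in> carrier (Hom C Y Z)\<rbrakk>
        \<Longrightarrow> cmp C X Y Z g f \<in> carrier (Hom C X Z)"
    and cmp_assoc:
      "\<lbrakk>W \<in> Ob C; X \<in> Ob C; Y \<in> Ob C; Z \<in> Ob C;
        f \<in> carrier (Hom C W X); g \<in> carrier (Hom C X Y); h \<in> carrier (Hom C Y Z)\<rbrakk>
        \<Longrightarrow> cmp C W X Z (cmp C X Y Z h g) f = cmp C W Y Z h (cmp C W X Y g f)"
    and ident_right:
      "\<lbrakk>X \<in> Ob C; Y \<in> Ob C; f \<in> carrier (Hom C X Y)\<rbrakk> \<Longrightarrow> cmp C X X Y f (ident C X) = f"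
    and ident_left:
      "\<lbrakk>X \<in> Ob C; Y \<in> Ob C; f \<in> carrier (Hom C X Y)\<rbrakk> \<Longrightarrow> cmp C X Y Y (ident C Y) f = f"
    and cmp_add_right:
      "\<lbrakk>X \<in> Ob C; Y \<in> Ob C; Z \<in> Ob C;
        f \<in> carrier (Hom C X Y); f' \<in> carrier (Hom C X Y); g \<in> carrier (Hom C Y Z)\<rbrakk>
        \<Longrightarrow> cmp C X Y Z g (f \<oplus>\<^bsub>Hom C X Y\<^esub> f')
            = cmp C X Y Z g f \<oplus>\<^bsub>Hom C X Z\<^esub> cmp C X Y Z g f'"
    and cmp_add_left:
      "\<lbrakk>X \<in> Ob C; Y \<in> Ob C; Z \<in> Ob C;
        f \<in> carrier (Hom C X Y); g \<in> carrier (Hom C Y Z); g' \<in> carrier (Hom C Y Z)\<rbrakk>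
        \<Longrightarrow> cmp C X Y Z (g \<oplus>\<^bsub>Hom C Y Z\<^esub> g') f
            = cmp C X Y Z g f \<oplus>\<^bsub>Hom C X Z\<^esub> cmp C X Y Z g' f"
    and cmp_smult_right:
      "\<lbrakk>X \<in> Ob C; Y \<in> Ob C; Z \<in> Ob C;
        a \<in> carrier R; f \<in> carrier (Hom C X Y); g \<in> carrier (Hom C Y Z)\<rbrakk>
        \<Longrightarrow> cmp C X Y Z g (a \<odot>\<^bsub>Hom C X Y\<^esub> f) = a \<odot>\<^bsub>Hom C X Z\<^esub> cmp C X Y Z g f"
    and cmp_smult_left:
      "\<lbrakk>X \<in> Ob C; Y \<in> Ob C; Z \<in> Ob C;
        a \<in> carrier R; f \<in> carrier (Hom C X Y); g \<in> carrier (Hom C Y Z)\<rbrakk>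
        \<Longrightarrow> cmp C X Y Z (a \<odot>\<^bsub>Hom C Y Z\<^esub> g) f = a \<odot>\<^bsub>Hom C X Z\<^esub> cmp C X Y Z g f"

record ('o1, 'm1, 'o2, 'm2) functor_data =
  fob :: "'o1 \<Rightarrow> 'o2"
  fmor :: "'o1 \<Rightarrow> 'o1 \<Rightarrow> 'm1 \<Rightarrow> 'm2"

text \<open>
  Functors are only required to be additive on morphism groups, so the two categories may be
  linear over different rings.
\<close>

locale additive_functor =
  fixes C :: "('o1, 'r, 'm1) lincat" and D :: "('o2, 's, 'm2) lincat"
    and F :: "('o1, 'm1, 'o2, 'm2) functor_data"
  assumes fob_closed: "X \<in> Ob C \<Longrightarrow> fob F X \<in> Ob D"
    and fmor_closed:
      "\<lbrakk>X \<in> Ob C; Y \<in> Ob C; f \<in> carrier (Hom C X Y)\<rbrakk>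
        \<Longrightarrow> fmor F X Y f \<in> carrier (Hom D (fob F X) (fob F Y))"
    and fmor_ident: "X \<in> Ob C \<Longrightarrow> fmor F X X (ident C X) = ident D (fob F X)"
    and fmor_cmp:
      "\<lbrakk>X \<in> Ob C; Y \<in> Ob C; Z \<in> Ob C; f \<in> carrier (Hom C X Y); g \<in> carrier (Hom C Y Z)\<rbrakk>
        \<Longrightarrow> fmor F X Z (cmp C X Y Z g f)
            = cmp D (fob F X) (fob F Y) (fob F Z) (fmor F Y Z g) (fmor F X Y f)"
    and fmor_add:
      "\<lbrakk>X \<in> Ob C; Y \<in> Ob C; f \<in> carrier (Hom C X Y); g \<in> carrier (Hom C X Y)\<rbrakk>
        \<Longrightarrow> fmor F X Y (f \<oplus>\<^bsub>Hom C X Y\<^esub> g)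
            = fmor F X Y f \<oplus>\<^bsub>Hom D (fob F X) (fob F Y)\<^esub> fmor F X Y g"

definition full_functor ::
  "('o1, 'r, 'm1) lincat \<Rightarrow> ('o2, 's, 'm2) lincat \<Rightarrow> ('o1, 'm1, 'o2, 'm2) functor_data \<Rightarrow> bool"
  where "full_functor C D F \<longleftrightarrow>
    (\<forall>X\<in>Ob C. \<forall>Y\<in>Ob C. fmor F X Y ` carrier (Hom C X Y) = carrier (Hom D (fob F X) (fob F Y)))"

definition kernel_square_zero ::
  "('o1, 'r, 'm1) lincat \<Rightarrow> ('o2, 's, 'm2) lincat \<Rightarrow> ('o1, 'm1, 'o2, 'm2) functor_data \<Rightarrow> bool"
  where "kernel_square_zero C D F \<longleftrightarrow>
    (\<forall>X\<in>Ob C. \<forall>Y\<in>Ob C. \<forall>Z\<in>Ob C. \<forall>f\<in>carrier (Hom C X Y). \<forall>g\<in>carrier (Hom C Y Z).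
      fmor F X Y f = \<zero>\<^bsub>Hom D (fob F X) (fob F Y)\<^esub> \<longrightarrow>
      fmor F Y Z g = \<zero>\<^bsub>Hom D (fob F Y) (fob F Z)\<^esub> \<longrightarrow>
      cmp C X Y Z g f = \<zero>\<^bsub>Hom C X Z\<^esub>)"


section \<open>Graded objects, graded maps and complexes\<close>

definition graded_object :: "('o, 'r, 'm) lincat \<Rightarrow> (int \<Rightarrow> 'o) \<Rightarrow> bool"
  where "graded_object C X \<longleftrightarrow> (\<forall>i. X i \<in> Ob C)"

text \<open>
  The group of graded maps of degree \<open>n\<close>. As for all groups in HOL-Algebra, its operation is
  written multiplicatively: \<open>\<one>\<close> is the zero map, \<open>\<otimes>\<close> is addition of maps, \<open>inv\<close> is negation, and
  \<open>gdiff\<close> is subtraction. The same applies to all cochain and cohomology groups below.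
\<close>

definition ghom :: "('o, 'r, 'm) lincat \<Rightarrow> (int \<Rightarrow> 'o) \<Rightarrow> (int \<Rightarrow> 'o) \<Rightarrow> int \<Rightarrow> (int \<Rightarrow> 'm) monoid"
  where "ghom C X Y n = product_group UNIV (\<lambda>i. add_monoid (Hom C (X i) (Y (i + n))))"

definition gdiff :: "'a monoid \<Rightarrow> 'a \<Rightarrow> 'a \<Rightarrow> 'a"
  where "gdiff G x y = x \<otimes>\<^bsub>G\<^esub> inv\<^bsub>G\<^esub> y"

definition gident :: "('o, 'r, 'm) lincat \<Rightarrow> (int \<Rightarrow> 'o) \<Rightarrow> int \<Rightarrow> 'm"
  where "gident C X = (\<lambda>i. ident C (X i))"

text \<open>\<open>gcomp C X Y Z m n g f\<close> is \<open>g f\<close>, for \<open>f : X \<rightarrow> Y\<close> of degree \<open>m\<close> and \<open>g : Y \<rightarrow> Z\<close> of degree \<open>n\<close>.\<close>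

definition gcomp ::
  "('o, 'r, 'm) lincat \<Rightarrow> (int \<Rightarrow> 'o) \<Rightarrow> (int \<Rightarrow> 'o) \<Rightarrow> (int \<Rightarrow> 'o) \<Rightarrow> int \<Rightarrow> int \<Rightarrow>
    (int \<Rightarrow> 'm) \<Rightarrow> (int \<Rightarrow> 'm) \<Rightarrow> (int \<Rightarrow> 'm)"
  where "gcomp C X Y Z m n g f =
    (\<lambda>i. cmp C (X i) (Y (i + m)) (Z (i + m + n)) (g (i + m)) (f i))"

definition graded_iso ::
  "('o, 'r, 'm) lincat \<Rightarrow> (int \<Rightarrow> 'o) \<Rightarrow> (int \<Rightarrow> 'o) \<Rightarrow> (int \<Rightarrow> 'm) \<Rightarrow> bool"
  where "graded_iso C X Y f \<longleftrightarrow>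
    f \<in> carrier (ghom C X Y 0) \<and>
    (\<exists>g\<in>carrier (ghom C Y X 0).
      gcomp C X Y X 0 0 g f = gident C X \<and> gcomp C Y X Y 0 0 f g = gident C Y)"

definition differential :: "('o, 'r, 'm) lincat \<Rightarrow> (int \<Rightarrow> 'o) \<Rightarrow> (int \<Rightarrow> 'm) \<Rightarrow> bool"
  where "differential C X d \<longleftrightarrow>
    d \<in> carrier (ghom C X X 1) \<and> gcomp C X X X 1 1 d d = \<one>\<^bsub>ghom C X X 2\<^esub>"

definition cochain_complex :: "('o, 'r, 'm) lincat \<Rightarrow> (int \<Rightarrow> 'o) \<Rightarrow> (int \<Rightarrow> 'm) \<Rightarrow> bool"
  where "cochain_complex C X d \<longleftrightarrow> graded_object C X \<and> differential C X d"

definition chain_map ::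
  "('o, 'r, 'm) lincat \<Rightarrow> (int \<Rightarrow> 'o) \<Rightarrow> (int \<Rightarrow> 'm) \<Rightarrow> (int \<Rightarrow> 'o) \<Rightarrow> (int \<Rightarrow> 'm) \<Rightarrow>
    (int \<Rightarrow> 'm) \<Rightarrow> bool"
  where "chain_map C X dX Y dY f \<longleftrightarrow>
    f \<in> carrier (ghom C X Y 0) \<and> gcomp C X Y Y 0 1 dY f = gcomp C X X Y 1 0 f dX"

definition complex_iso ::
  "('o, 'r, 'm) lincat \<Rightarrow> (int \<Rightarrow> 'o) \<Rightarrow> (int \<Rightarrow> 'm) \<Rightarrow> (int \<Rightarrow> 'o) \<Rightarrow> (int \<Rightarrow> 'm) \<Rightarrow>
    (int \<Rightarrow> 'm) \<Rightarrow> bool"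
  where "complex_iso C X dX Y dY f \<longleftrightarrow>
    chain_map C X dX Y dY f \<and>
    (\<exists>g. chain_map C Y dY X dX g \<and>
      gcomp C X Y X 0 0 g f = gident C X \<and> gcomp C Y X Y 0 0 f g = gident C Y)"

text \<open>The sign \<open>(-1)\<^sup>n\<close> for an integer degree \<open>n\<close> is rendered by a case distinction on parity.\<close>

definition gdelta ::
  "('o, 'r, 'm) lincat \<Rightarrow> (int \<Rightarrow> 'o) \<Rightarrow> (int \<Rightarrow> 'm) \<Rightarrow> (int \<Rightarrow> 'o) \<Rightarrow> (int \<Rightarrow> 'm) \<Rightarrow>
    int \<Rightarrow> (int \<Rightarrow> 'm) \<Rightarrow> (int \<Rightarrow> 'm)"
  where "gdelta C X dX Y dY n f =
    (if even n
     then gdiff (ghom C X Y (n + 1)) (gcomp C X Y Y n 1 dY f) (gcomp C X X Y 1 n f dX)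
     else gcomp C X Y Y n 1 dY f \<otimes>\<^bsub>ghom C X Y (n + 1)\<^esub> gcomp C X X Y 1 n f dX)"


section \<open>Graded lifts\<close>

definition fgob :: "('o1, 'm1, 'o2, 'm2) functor_data \<Rightarrow> (int \<Rightarrow> 'o1) \<Rightarrow> int \<Rightarrow> 'o2"
  where "fgob F X = (\<lambda>i. fob F (X i))"

definition fgmor ::
  "('o1, 'm1, 'o2, 'm2) functor_data \<Rightarrow> (int \<Rightarrow> 'o1) \<Rightarrow> (int \<Rightarrow> 'o1) \<Rightarrow> int \<Rightarrow>
    (int \<Rightarrow> 'm1) \<Rightarrow> int \<Rightarrow> 'm2"
  where "fgmor F X Y n f = (\<lambda>i. fmor F (X i) (Y (i + n)) (f i))"

definition graded_object_lift ::
  "('o1, 'r, 'm1) lincat \<Rightarrow> ('o2, 's, 'm2) lincat \<Rightarrow> ('o1, 'm1, 'o2, 'm2) functor_data \<Rightarrow>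
    (int \<Rightarrow> 'o2) \<Rightarrow> (int \<Rightarrow> 'o1) \<Rightarrow> (int \<Rightarrow> 'm2) \<Rightarrow> bool"
  where "graded_object_lift CB C F X XB c \<longleftrightarrow> graded_object CB XB \<and> graded_iso C X (fgob F XB) c"

text \<open>
  \<open>graded_map_lift CB C F X XB c Y YB c' n f fB\<close>: the map \<open>fB : XB \<rightarrow> YB\<close> is a graded lift of the
  degree \<open>n\<close> map \<open>f : X \<rightarrow> Y\<close>, relative to the graded lifts \<open>c : X \<cong> F(XB)\<close> and \<open>c' : Y \<cong> F(YB)\<close>.
\<close>

definition graded_map_lift ::
  "('o1, 'r, 'm1) lincat \<Rightarrow> ('o2, 's, 'm2) lincat \<Rightarrow> ('o1, 'm1, 'o2, 'm2) functor_data \<Rightarrow>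
    (int \<Rightarrow> 'o2) \<Rightarrow> (int \<Rightarrow> 'o1) \<Rightarrow> (int \<Rightarrow> 'm2) \<Rightarrow>
    (int \<Rightarrow> 'o2) \<Rightarrow> (int \<Rightarrow> 'o1) \<Rightarrow> (int \<Rightarrow> 'm2) \<Rightarrow>
    int \<Rightarrow> (int \<Rightarrow> 'm2) \<Rightarrow> (int \<Rightarrow> 'm1) \<Rightarrow> bool"
  where "graded_map_lift CB C F X XB c Y YB c' n f fB \<longleftrightarrow>
    fB \<in> carrier (ghom CB XB YB n) \<and>
    gcomp C X (fgob F XB) (fgob F YB) 0 n (fgmor F XB YB n fB) c
      = gcomp C X Y (fgob F YB) n 0 c' f"


section \<open>Cohomology\<close>

definition cocycles :: "(int \<Rightarrow> 'a monoid) \<Rightarrow> (int \<Rightarrow> 'a \<Rightarrow> 'a) \<Rightarrow> int \<Rightarrow> 'a monoid"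
  where "cocycles K D n = (K n)\<lparr>carrier := {z \<in> carrier (K n). D n z = \<one>\<^bsub>K (n + 1)\<^esub>}\<rparr>"

definition coboundaries :: "(int \<Rightarrow> 'a monoid) \<Rightarrow> (int \<Rightarrow> 'a \<Rightarrow> 'a) \<Rightarrow> int \<Rightarrow> 'a set"
  where "coboundaries K D n = D (n - 1) ` carrier (K (n - 1))"

definition cohomology :: "(int \<Rightarrow> 'a monoid) \<Rightarrow> (int \<Rightarrow> 'a \<Rightarrow> 'a) \<Rightarrow> int \<Rightarrow> 'a set monoid"
  where "cohomology K D n = cocycles K D n Mod coboundaries K D n"

definition cohomology_class ::
  "(int \<Rightarrow> 'a monoid) \<Rightarrow> (int \<Rightarrow> 'a \<Rightarrow> 'a) \<Rightarrow> int \<Rightarrow> 'a \<Rightarrow> 'a set"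
  where "cohomology_class K D n z = coboundaries K D n #>\<^bsub>cocycles K D n\<^esub> z"

definition kernel_cochains ::
  "('o1, 'r, 'm1) lincat \<Rightarrow> ('o2, 's, 'm2) lincat \<Rightarrow> ('o1, 'm1, 'o2, 'm2) functor_data \<Rightarrow>
    (int \<Rightarrow> 'o1) \<Rightarrow> int \<Rightarrow> (int \<Rightarrow> 'm1) monoid"
  where "kernel_cochains CB C F XB n =
    (ghom CB XB XB n)\<lparr>carrier :=
      {h \<in> carrier (ghom CB XB XB n). fgmor F XB XB n h = \<one>\<^bsub>ghom C (fgob F XB) (fgob F XB) n\<^esub>}\<rparr>"


section \<open>The bigroupoid of lifts of a differential\<close>

definition lift_objects ::
  "('o1, 'r, 'm1) lincat \<Rightarrow> ('o2, 's, 'm2) lincat \<Rightarrow> ('o1, 'm1, 'o2, 'm2) functor_data \<Rightarrow>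
    (int \<Rightarrow> 'o2) \<Rightarrow> (int \<Rightarrow> 'o1) \<Rightarrow> (int \<Rightarrow> 'm2) \<Rightarrow> (int \<Rightarrow> 'm2) \<Rightarrow> (int \<Rightarrow> 'm1) set"
  where "lift_objects CB C F X XB c d =
    {dB. graded_map_lift CB C F X XB c X XB c 1 d dB \<and> differential CB XB dB}"

definition lift_1cells ::
  "('o1, 'r, 'm1) lincat \<Rightarrow> ('o2, 's, 'm2) lincat \<Rightarrow> ('o1, 'm1, 'o2, 'm2) functor_data \<Rightarrow>
    (int \<Rightarrow> 'o2) \<Rightarrow> (int \<Rightarrow> 'o1) \<Rightarrow> (int \<Rightarrow> 'm2) \<Rightarrow>
    (int \<Rightarrow> 'm1) \<Rightarrow> (int \<Rightarrow> 'm1) \<Rightarrow> (int \<Rightarrow> 'm1) set"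
  where "lift_1cells CB C F X XB c dB dB' =
    {u. graded_map_lift CB C F X XB c X XB c 0 (gident C X) u \<and> complex_iso CB XB dB XB dB' u}"

definition lift_2cells ::
  "('o1, 'r, 'm1) lincat \<Rightarrow> ('o2, 's, 'm2) lincat \<Rightarrow> ('o1, 'm1, 'o2, 'm2) functor_data \<Rightarrow>
    (int \<Rightarrow> 'o1) \<Rightarrow> (int \<Rightarrow> 'm1) \<Rightarrow> (int \<Rightarrow> 'm1) \<Rightarrow>
    (int \<Rightarrow> 'm1) \<Rightarrow> (int \<Rightarrow> 'm1) \<Rightarrow> (int \<Rightarrow> 'm1) set"
  where "lift_2cells CB C F XB dB dB' u u' =
    {h \<in> carrier (ghom CB XB XB (-1)).
      fgmor F XB XB (-1) h = \<one>\<^bsub>ghom C (fgob F XB) (fgob F XB) (-1)\<^esub> \<and>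
      gdelta CB XB dB XB dB' (-1) h = gdiff (ghom CB XB XB 0) u' u}"

text \<open>
  Objects \<open>x\<close>, \<open>y\<close> of \<open>obs\<close> are identified in the skeleton if the set \<open>cells x y\<close> of cells from \<open>x\<close>
  to \<open>y\<close> is inhabited. For a groupoid, all of whose morphisms are invertible, \<open>Sk\<close> is the set
  of isomorphism classes of objects.
\<close>

definition sk_rel :: "'a set \<Rightarrow> ('a \<Rightarrow> 'a \<Rightarrow> 'b set) \<Rightarrow> ('a \<times> 'a) set"
  where "sk_rel obs cells = {(x, y). x \<in> obs \<and> y \<in> obs \<and> cells x y \<noteq> {}}"

definition sk_class :: "'a set \<Rightarrow> ('a \<Rightarrow> 'a \<Rightarrow> 'b set) \<Rightarrow> 'a \<Rightarrow> 'a set"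
  where "sk_class obs cells x = sk_rel obs cells `` {x}"

definition Sk :: "'a set \<Rightarrow> ('a \<Rightarrow> 'a \<Rightarrow> 'b set) \<Rightarrow> 'a set set"
  where "Sk obs cells = obs // sk_rel obs cells"


section \<open>Affine structures\<close>

definition affine_structure :: "'g monoid \<Rightarrow> 'e set \<Rightarrow> ('g \<Rightarrow> 'e \<Rightarrow> 'e) \<Rightarrow> bool"
  where "affine_structure A E \<phi> \<longleftrightarrow>
    comm_group A \<and> group_action A E \<phi> \<and> E \<noteq> {} \<and>
    (\<forall>x\<in>E. \<forall>y\<in>E. \<exists>!a. a \<in> carrier A \<and> \<phi> a x = y)"

definition affine_difference :: "'g monoid \<Rightarrow> ('g \<Rightarrow> 'e \<Rightarrow> 'e) \<Rightarrow> 'e \<Rightarrow> 'e \<Rightarrow> 'g"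
  where "affine_difference A \<phi> x y = (THE a. a \<in> carrier A \<and> \<phi> a x = y)"

text \<open>
  A map \<open>v\<close> on pairs of elements of \<open>X\<close> induces an \<open>A\<close>-affine structure on a quotient \<open>E\<close> of \<open>X\<close>,
  with quotient map \<open>p\<close>, if \<open>v\<close> is the pullback along \<open>p\<close> of the difference map of such a structure.
  That structure is then unique, as \<open>p\<close> is onto.
\<close>

definition induces_affine_structure ::
  "'g monoid \<Rightarrow> 'e set \<Rightarrow> 'x set \<Rightarrow> ('x \<Rightarrow> 'e) \<Rightarrow> ('x \<Rightarrow> 'x \<Rightarrow> 'g) \<Rightarrow> bool"
  where "induces_affine_structure A E X p v \<longleftrightarrow>
    p ` X = E \<and>
    (\<exists>\<phi>. affine_structure A E \<phi> \<and> (\<forall>x\<in>X. \<forall>y\<in>X. affine_difference A \<phi> (p x) (p y) = v x y))"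

end

theory Submission
  imports Defs
begin

text \<open>
  Graded endomorphisms of \<open>XB\<close> form a graded ring \<open>A\<close>, and those killed by the functor form a graded
  ideal \<open>I\<close> with \<open>I I = 0\<close>. Write \<open>I\<^sup>n\<close> for the part of \<open>I\<close> of degree \<open>n\<close>. Since \<open>c\<close> is
  invertible, the lifts of a given graded map form a coset of \<open>I\<close> (\<open>graded_map_lift_iff\<close>), nonempty
  because the functor is full. This reduces everything to \<open>A\<close> and \<open>I\<close>: lifts of \<open>d\<close> are
  \<open>d\<^sub>0 + I\<^sup>1\<close>, lifts of the identity are \<open>1 + I\<^sup>0\<close>, and \<open>d\<^sub>0\<^sup>2 \<in> I\<^sup>2\<close>
  because \<open>d\<^sup>2 = 0\<close>.

  Products inside \<open>I\<close> vanish, so the graded commutator \<open>\<delta>\<close> with a lift is the same on \<open>I\<close> for all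
  lifts, it satisfies \<open>\<delta>\<^sup>2 = 0\<close>, and every quadratic expression becomes linear in \<open>k \<in> I\<^sup>1\<close> and
  \<open>h \<in> I\<^sup>0\<close>:

  \<^item> \<open>(k + d)\<^sup>2 = \<delta> k + d\<^sup>2\<close> (\<open>square_translate\<close>). Hence the class of \<open>d\<^sup>2\<close> is independent of the lift
    and vanishes exactly if some lift has square zero, and the square-zero lifts form a coset of the
    1-cocycles.
  \<^item> \<open>d' (h + u) - (h + u) d = \<delta> h + (d' u - u d)\<close> (\<open>commutator_translate\<close>). With \<open>u = 1\<close> this says
    that \<open>h + 1\<close> is a cell from \<open>d\<close> to \<open>d'\<close> exactly if \<open>\<delta> h = d - d'\<close>, so cells detect coboundaries;
    with \<open>u\<close> itself a cell it says that the cells form a coset of the 0-cocycles.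
  \<^item> A 2-cell \<open>h : u \<rightarrow> u'\<close> is by definition a cochain with \<open>\<delta> h = u' - u\<close>.

  Both affine structures are now instances of one fact about abelian groups \<open>B \<le> Z \<le> G\<close>: a coset
  of \<open>Z\<close> modulo translation by \<open>B\<close> is a torsor under \<open>Z / B\<close> (\<open>affine\<close>, \<open>induces_affine\<close>).
\<close>

section \<open>Cosets of a subgroup as torsors\<close>

lemma sk_rel_cong:
  assumes "\<And>x y. \<lbrakk>x \<in> obs; y \<in> obs\<rbrakk> \<Longrightarrow> cells x y = cells' x y"
  shows "sk_rel obs cells = sk_rel obs cells'"
  using assms by (auto simp: sk_rel_def)

lemma gdiff_closed:
  assumes "group G" "x \<in> carrier G" "y \<in> carrier G"
  shows "gdiff G x y \<in> carrier G"
proof -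
  interpret group G by fact
  show ?thesis using assms by (simp add: gdiff_def)
qed

lemma gdiff_eq_iff:
  assumes "group G" "x \<in> carrier G" "y \<in> carrier G" "z \<in> carrier G"
  shows "gdiff G x y = z \<longleftrightarrow> x = z \<otimes>\<^bsub>G\<^esub> y"
proof -
  interpret group G by fact
  show ?thesis unfolding gdiff_def using assms by (metis inv_solve_right)
qed

lemma gdiff_mult_cancel:
  assumes "group G" "x \<in> carrier G" "y \<in> carrier G"
  shows "gdiff G x y \<otimes>\<^bsub>G\<^esub> y = x"
proof -
  interpret group G by fact
  show ?thesis using assms by (simp add: gdiff_def inv_solve_right' m_assoc)
qed

lemma mem_rcoset_iff_gdiff:
  assumes "group G" "subgroup H G" "x \<in> carrier G" "y \<in> carrier G"
  shows "y \<in> H #>\<^bsub>G\<^esub> x \<longleftrightarrow> gdiff G y x \<in> H"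
proof -
  interpret group G by fact
  show ?thesis
  proof
    assume "y \<in> H #>\<^bsub>G\<^esub> x"
    then obtain h where h: "h \<in> H" "y = h \<otimes>\<^bsub>G\<^esub> x" by (auto simp: r_coset_def)
    then have "h \<in> carrier G" using assms(2) subgroup.mem_carrier by metis
    with h assms show "gdiff G y x \<in> H" by (simp add: gdiff_def m_assoc)
  next
    assume "gdiff G y x \<in> H"
    then show "y \<in> H #>\<^bsub>G\<^esub> x"
      using gdiff_mult_cancel[OF assms(1,4,3)] by (auto simp: r_coset_def intro!: bexI)
  qed
qed

lemma rcoset_eq_iff_gdiff:
  assumes "group G" "subgroup H G" "x \<in> carrier G" "y \<in> carrier G"
  shows "H #>\<^bsub>G\<^esub> x = H #>\<^bsub>G\<^esub> y \<longleftrightarrow> gdiff G y x \<in> H"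
proof -
  interpret group G by fact
  show ?thesis
    using mem_rcoset_iff_gdiff[OF assms] repr_independence[OF _ assms(3,2), of y]
      rcos_self[OF assms(4,2)] by blast
qed

locale coset_pair = comm_group G for G :: "'a monoid" (structure) +
  fixes Z B x0 X
  assumes Z: "subgroup Z G" and B: "subgroup B G" and B_le: "B \<subseteq> Z"
    and x0: "x0 \<in> carrier G" and X_def: "X = Z #> x0"
begin

abbreviation "ZG \<equiv> G\<lparr>carrier := Z\<rparr>"
abbreviation "Q \<equiv> ZG Mod B"

lemma Z_carrier: "z \<in> Z \<Longrightarrow> z \<in> carrier G"
  using Z subgroup.mem_carrier by metis

lemma X_carrier: "x \<in> X \<Longrightarrow> x \<in> carrier G"
  using r_coset_subset_G[OF subgroup.subset[OF Z] x0] X_def by auto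

lemma translate_mem: "\<lbrakk>z \<in> Z; x \<in> X\<rbrakk> \<Longrightarrow> z \<otimes> x \<in> X"
  unfolding X_def r_coset_def using subgroup.m_closed[OF Z] Z_carrier x0 m_assoc
  by simp (metis)

lemma gdiff_mem: "\<lbrakk>x \<in> X; y \<in> X\<rbrakk> \<Longrightarrow> gdiff G y x \<in> Z"
  using mem_rcoset_iff_gdiff[OF is_group Z, of x y] repr_independence[OF _ x0 Z, of x] X_carrier
  unfolding X_def by blast

lemma x0_mem: "x0 \<in> X"
  using rcos_self[OF x0 Z] X_def by simp

lemma B_normal: "B \<lhd> G"
  using B by (simp add: subgroup_imp_normal)

lemma comm_group_ZG: "comm_group ZG"
  using subgroup.subgroup_is_group[OF Z is_group]
  by (rule group.group_comm_groupI) (simp add: m_comm Z_carrier)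

lemma Q_comm_group: "comm_group Q"
  using comm_group.abelian_FactGroup[OF comm_group_ZG] subgroup_incl[OF B Z B_le] by simp

lemma carrier_Q: "carrier Q = (\<lambda>z. B #> z) ` Z"
  by (auto simp: FactGroup_def RCOSETS_def r_coset_def)

lemma mult_Q: "a \<otimes>\<^bsub>Q\<^esub> b = a <#> b"
  by (simp add: FactGroup_def set_mult_def)

lemma coset_mult:
  "\<lbrakk>x \<in> carrier G; y \<in> carrier G\<rbrakk> \<Longrightarrow> (B #> x) <#> (B #> y) = B #> (x \<otimes> y)"
  using normal.rcos_sum[OF B_normal] by simp

definition act where "act a = restrict (\<lambda>S. a <#> S) ((\<lambda>x. B #> x) ` X)"

lemma act_coset: "\<lbrakk>z \<in> Z; x \<in> X\<rbrakk> \<Longrightarrow> act (B #> z) (B #> x) = B #> (z \<otimes> x)"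
  by (simp add: act_def coset_mult Z_carrier X_carrier)

lemma act_eq_iff:
  assumes "z \<in> Z" "x \<in> X" "y \<in> X"
  shows "act (B #> z) (B #> x) = B #> y \<longleftrightarrow> B #> z = B #> gdiff G y x"
proof -
  have "gdiff G y (z \<otimes> x) = gdiff G (gdiff G y x) z"
    using assms Z_carrier X_carrier by (simp add: gdiff_def inv_mult m_ac)
  then show ?thesis
    using assms Z_carrier X_carrier
    by (simp add: act_coset rcoset_eq_iff_gdiff[OF is_group B] gdiff_closed)
qed

text \<open>
  For abelian \<open>B \<le> Z \<le> G\<close>, translation makes the coset \<open>Z x\<^sub>0\<close> a torsor under \<open>Z\<close>; dividing
  both by \<open>B\<close> gives a torsor under \<open>Z / B\<close>. The action is the product of cosets of \<open>B\<close> in \<open>G\<close>.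
\<close>

lemma affine: "affine_structure Q ((\<lambda>x. B #> x) ` X) act" (is "affine_structure Q ?E act")
proof -
  interpret Q: comm_group Q by (rule Q_comm_group)
  have closed: "act a S \<in> ?E" if "a \<in> carrier Q" "S \<in> ?E" for a S
    using that by (auto simp: carrier_Q act_coset translate_mem)
  have mult: "act (a \<otimes>\<^bsub>Q\<^esub> b) S = act a (act b S)"
    if "a \<in> carrier Q" "b \<in> carrier Q" "S \<in> ?E" for a b S
    using that unfolding carrier_Q
    by (auto simp: mult_Q coset_mult act_coset translate_mem Z_carrier X_carrier
        subgroup.m_closed[OF Z] m_assoc)
  have one: "act \<one>\<^bsub>Q\<^esub> S = S" if "S \<in> ?E" for S
  proof -
    obtain x where x: "x \<in> X" "S = B #> x" using \<open>S \<in> ?E\<close> by blast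
    have "\<one>\<^bsub>Q\<^esub> = B #> \<one>"
      using coset_mult_one subgroup.subset[OF B] by (simp add: FactGroup_def)
    then show ?thesis
      using act_coset[OF subgroup.one_closed[OF Z] x(1)] x by (simp add: X_carrier)
  qed
  have bij: "act a \<in> Bij ?E" if a: "a \<in> carrier Q" for a
  proof -
    have "bij_betw (act a) ?E ?E"
    proof (rule bij_betw_byWitness[where f' = "act (inv\<^bsub>Q\<^esub> a)"])
      show "\<forall>S\<in>?E. act (inv\<^bsub>Q\<^esub> a) (act a S) = S"
        using a mult[of "inv\<^bsub>Q\<^esub> a" a] one by (metis Q.inv_closed Q.l_inv)
      show "\<forall>S\<in>?E. act a (act (inv\<^bsub>Q\<^esub> a) S) = S"
        using a mult[of a "inv\<^bsub>Q\<^esub> a"] one by (metis Q.inv_closed Q.r_inv)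
      show "act a ` ?E \<subseteq> ?E" "act (inv\<^bsub>Q\<^esub> a) ` ?E \<subseteq> ?E"
        using a closed Q.inv_closed by blast+
    qed
    then show ?thesis by (simp add: Bij_def act_def)
  qed
  have "group_action Q ?E act"
    unfolding group_action_def group_hom_def group_hom_axioms_def
  proof (intro conjI homI group_BijGroup)
    show "group Q" ..
    show "act a \<in> carrier (BijGroup ?E)" if "a \<in> carrier Q" for a
      using bij[OF that] by (simp add: BijGroup_def)
    show "act (a \<otimes>\<^bsub>Q\<^esub> b) = act a \<otimes>\<^bsub>BijGroup ?E\<^esub> act b"
      if "a \<in> carrier Q" "b \<in> carrier Q" for a b
    proof (rule extensionalityI[where A = ?E])
      show "act (a \<otimes>\<^bsub>Q\<^esub> b) \<in> extensional ?E" by (simp add: act_def)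
      show "act a \<otimes>\<^bsub>BijGroup ?E\<^esub> act b \<in> extensional ?E"
        using that bij by (simp add: BijGroup_def compose_def)
      show "act (a \<otimes>\<^bsub>Q\<^esub> b) S = (act a \<otimes>\<^bsub>BijGroup ?E\<^esub> act b) S" if "S \<in> ?E" for S
        unfolding mult[OF \<open>a \<in> carrier Q\<close> \<open>b \<in> carrier Q\<close> that]
        using \<open>a \<in> carrier Q\<close> \<open>b \<in> carrier Q\<close> that bij by (simp add: BijGroup_def compose_def)
    qed
  qed
  moreover have "\<exists>!a. a \<in> carrier Q \<and> act a S = T" if "S \<in> ?E" "T \<in> ?E" for S T
    using that unfolding carrier_Q by (auto simp: act_eq_iff intro!: gdiff_mem)
  ultimately show ?thesis
    using Q_comm_group x0_mem by (auto simp: affine_structure_def)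
qed

text \<open>
  The cells enter only through their existence: two points of the torsor are linked exactly if
  they differ by an element of \<open>B\<close>, so that skeleton classes are cosets of \<open>B\<close>.
\<close>

context
  fixes cells :: "'a \<Rightarrow> 'a \<Rightarrow> 'c set"
  assumes cells: "\<And>x y. \<lbrakk>x \<in> X; y \<in> X\<rbrakk> \<Longrightarrow> cells x y \<noteq> {} \<longleftrightarrow> gdiff G y x \<in> B"
begin

lemma sk_class_coset: "x \<in> X \<Longrightarrow> sk_class X cells x = B #> x"
proof -
  assume x: "x \<in> X"
  have "y \<in> X" if "y \<in> B #> x" for y
    using that B_le translate_mem[OF _ x] by (auto simp: r_coset_def)
  moreover have "y \<in> B #> x \<longleftrightarrow> gdiff G y x \<in> B" if "y \<in> X" for y
    using mem_rcoset_iff_gdiff[OF is_group B] x that X_carrier by blast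
  moreover have "sk_class X cells x = {y \<in> X. gdiff G y x \<in> B}"
    using x cells[OF x] unfolding sk_class_def sk_rel_def by blast
  ultimately show ?thesis by blast
qed

lemma Sk_cosets: "Sk X cells = (\<lambda>x. B #> x) ` X"
proof -
  have "Sk X cells = sk_class X cells ` X"
    by (auto simp: Sk_def quotient_def sk_class_def)
  then show ?thesis by (simp add: sk_class_coset)
qed

lemma difference_class:
  assumes "x \<in> X" "y \<in> X"
  shows "B #>\<^bsub>ZG\<^esub> gdiff G y x \<in> carrier Q"
    and "B #>\<^bsub>ZG\<^esub> gdiff G y x = \<one>\<^bsub>Q\<^esub> \<longleftrightarrow> sk_class X cells x = sk_class X cells y"
    and "B #>\<^bsub>ZG\<^esub> gdiff G y x = \<one>\<^bsub>Q\<^esub> \<longleftrightarrow> gdiff G y x \<in> B"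
proof -
  have eq: "B #>\<^bsub>ZG\<^esub> z = B #> z" for z by (simp add: r_coset_def)
  show "B #>\<^bsub>ZG\<^esub> gdiff G y x \<in> carrier Q"
    using gdiff_mem[OF assms] by (auto simp: carrier_Q eq)
  show *: "B #>\<^bsub>ZG\<^esub> gdiff G y x = \<one>\<^bsub>Q\<^esub> \<longleftrightarrow> gdiff G y x \<in> B"
    using coset_join1[OF _ Z_carrier[OF gdiff_mem[OF assms]] B]
      coset_join2[OF Z_carrier[OF gdiff_mem[OF assms]] B]
    by (auto simp: eq FactGroup_def)
  then show "B #>\<^bsub>ZG\<^esub> gdiff G y x = \<one>\<^bsub>Q\<^esub> \<longleftrightarrow> sk_class X cells x = sk_class X cells y"
    using assms by (simp add: sk_class_coset rcoset_eq_iff_gdiff[OF is_group B] X_carrier)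
qed

lemma induces_affine:
  "induces_affine_structure Q (Sk X cells) X (sk_class X cells) (\<lambda>x y. B #>\<^bsub>ZG\<^esub> gdiff G y x)"
proof -
  have eq: "B #>\<^bsub>ZG\<^esub> z = B #> z" for z by (simp add: r_coset_def)
  have "affine_difference Q act (B #> x) (B #> y) = B #> gdiff G y x"
    if "x \<in> X" "y \<in> X" for x y
    unfolding affine_difference_def
    using that gdiff_mem by (intro the_equality) (auto simp: carrier_Q act_eq_iff)
  then show ?thesis
    using affine by (auto simp: induces_affine_structure_def Sk_cosets sk_class_coset eq
        intro!: exI[of _ act])
qed

end

end


section \<open>Cochain complexes of abelian groups\<close>

locale cochain_groups =
  fixes K :: "int \<Rightarrow> 'a monoid" and D :: "int \<Rightarrow> 'a \<Rightarrow> 'a"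
  assumes K_comm_group: "comm_group (K n)"
    and D_hom: "D n \<in> hom (K n) (K (n + 1))"
    and D_D: "f \<in> carrier (K n) \<Longrightarrow> D (n + 1) (D n f) = \<one>\<^bsub>K (n + 1 + 1)\<^esub>"
begin

lemma D_group_hom: "group_hom (K n) (K (n + 1)) (D n)"
  using K_comm_group D_hom by (simp add: group_hom_def group_hom_axioms_def comm_group.axioms)

lemma cocycles_subgroup: "subgroup (carrier (cocycles K D n)) (K n)"
  using group_hom.subgroup_kernel[OF D_group_hom] by (simp add: cocycles_def kernel_def)

lemma coboundaries_subgroup: "subgroup (coboundaries K D n) (K n)"
  using group_hom.img_is_subgroup[OF D_group_hom, of "n - 1"] by (simp add: coboundaries_def)

lemma coboundaries_le_cocycles: "coboundaries K D n \<subseteq> carrier (cocycles K D n)"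
  using D_D[of _ "n - 1"] subgroup.subset[OF coboundaries_subgroup]
  by (auto simp: coboundaries_def cocycles_def)

lemma cohomology_class_closed:
  "z \<in> carrier (cocycles K D n) \<Longrightarrow> cohomology_class K D n z \<in> carrier (cohomology K D n)"
  by (auto simp: cohomology_class_def cohomology_def FactGroup_def RCOSETS_def)

lemma cohomology_class_eq_iff:
  assumes "z \<in> carrier (cocycles K D n)" "z' \<in> carrier (cocycles K D n)"
  shows "cohomology_class K D n z = cohomology_class K D n z' \<longleftrightarrow>
    gdiff (K n) z' z \<in> coboundaries K D n"
proof -
  have "cohomology_class K D n y = coboundaries K D n #>\<^bsub>K n\<^esub> y" for y
    by (simp add: cohomology_class_def cocycles_def r_coset_def)
  then show ?thesis
    using assms rcoset_eq_iff_gdiff[OF _ coboundaries_subgroup] K_comm_group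
    by (simp add: cocycles_def comm_group.axioms)
qed

lemma cohomology_class_eq_one_iff:
  assumes "z \<in> carrier (cocycles K D n)"
  shows "cohomology_class K D n z = \<one>\<^bsub>cohomology K D n\<^esub> \<longleftrightarrow> z \<in> coboundaries K D n"
proof -
  interpret group "K n" using K_comm_group comm_group.axioms by blast
  have "cohomology_class K D n z = coboundaries K D n #>\<^bsub>K n\<^esub> z"
    by (simp add: cohomology_class_def cocycles_def r_coset_def)
  moreover have "\<one>\<^bsub>cohomology K D n\<^esub> = coboundaries K D n"
    by (simp add: cohomology_def FactGroup_def)
  moreover have "z \<in> carrier (K n)" using assms by (simp add: cocycles_def)
  ultimately show ?thesis
    using coset_join1[of "coboundaries K D n"] coset_join2[of _ "coboundaries K D n"]
      coboundaries_subgroup by metis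
qed

end


section \<open>Square-zero ideals in graded rings\<close>

text \<open>
  \<open>mul m n g f\<close> is the product of \<open>g\<close> of degree \<open>n\<close> with \<open>f\<close> of degree \<open>m\<close>; the degrees are in
  the order in which the factors act as maps. Each homogeneous part is a multiplicatively written
  abelian group, so that \<open>\<one>\<close> is the zero of the graded ring and \<open>e\<close> its unit.
\<close>

locale square_zero_ideal =
  fixes A :: "int \<Rightarrow> 'a monoid" and mul :: "int \<Rightarrow> int \<Rightarrow> 'a \<Rightarrow> 'a \<Rightarrow> 'a" and e :: 'a
    and I :: "int \<Rightarrow> 'a set"
  assumes A_comm_group: "comm_group (A n)"
    and mul_hom_right: "g \<in> carrier (A n) \<Longrightarrow> mul m n g \<in> hom (A m) (A (m + n))"
    and mul_hom_left: "f \<in> carrier (A m) \<Longrightarrow> (\<lambda>g. mul m n g f) \<in> hom (A n) (A (m + n))"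
    and mul_assoc: "\<lbrakk>f \<in> carrier (A m); g \<in> carrier (A n); h \<in> carrier (A p)\<rbrakk>
      \<Longrightarrow> mul (m + n) p h (mul m n g f) = mul m (n + p) (mul n p h g) f"
    and e_closed: "e \<in> carrier (A 0)"
    and e_left: "f \<in> carrier (A n) \<Longrightarrow> mul n 0 e f = f"
    and e_right: "f \<in> carrier (A n) \<Longrightarrow> mul 0 n f e = f"
    and I_subgroup: "subgroup (I n) (A n)"
    and I_left: "\<lbrakk>f \<in> I m; g \<in> carrier (A n)\<rbrakk> \<Longrightarrow> mul m n g f \<in> I (m + n)"
    and I_right: "\<lbrakk>f \<in> carrier (A m); g \<in> I n\<rbrakk> \<Longrightarrow> mul m n g f \<in> I (m + n)"
    and I_square: "\<lbrakk>f \<in> I m; g \<in> I n\<rbrakk> \<Longrightarrow> mul m n g f = \<one>\<^bsub>A (m + n)\<^esub>"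
begin

sublocale A: comm_group "A n" for n by (rule A_comm_group)

lemma I_carrier: "f \<in> I n \<Longrightarrow> f \<in> carrier (A n)"
  using I_subgroup subgroup.mem_carrier by metis

lemma I_mult: "\<lbrakk>f \<in> I n; g \<in> I n\<rbrakk> \<Longrightarrow> f \<otimes>\<^bsub>A n\<^esub> g \<in> I n"
  using I_subgroup subgroup.m_closed by metis

lemma I_inv: "f \<in> I n \<Longrightarrow> inv\<^bsub>A n\<^esub> f \<in> I n"
  using I_subgroup subgroup.m_inv_closed by metis

lemma right_group_hom: "g \<in> carrier (A n) \<Longrightarrow> group_hom (A m) (A (m + n)) (mul m n g)"
  using mul_hom_right by (simp add: group_hom_def group_hom_axioms_def A.is_group)

lemma left_group_hom: "f \<in> carrier (A m) \<Longrightarrow> group_hom (A n) (A (m + n)) (\<lambda>g. mul m n g f)"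
  using mul_hom_left by (simp add: group_hom_def group_hom_axioms_def A.is_group)

lemma mul_closed:
  "\<lbrakk>f \<in> carrier (A m); g \<in> carrier (A n); p = m + n\<rbrakk> \<Longrightarrow> mul m n g f \<in> carrier (A p)"
  using group_hom.hom_closed[OF right_group_hom] by simp

lemmas mul_mult_right = group_hom.hom_mult[OF right_group_hom]
lemmas mul_mult_left = group_hom.hom_mult[OF left_group_hom]
lemmas mul_inv_right = group_hom.hom_inv[OF right_group_hom]
lemmas mul_inv_left = group_hom.hom_inv[OF left_group_hom]

definition delta where
  "delta d d' n f = (if even n then gdiff (A (n + 1)) (mul n 1 d' f) (mul 1 n f d)
     else mul n 1 d' f \<otimes>\<^bsub>A (n + 1)\<^esub> mul 1 n f d)"

text \<open>
  This is \<open>-(-1)\<^sup>n x\<close>: it turns both parity cases of \<open>delta\<close> into one product.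
\<close>

definition signed where "signed n p x = (if even n then inv\<^bsub>A p\<^esub> x else x)" for n :: int

lemma delta_signed:
  "delta d d' n f = mul n 1 d' f \<otimes>\<^bsub>A (n + 1)\<^esub> signed n (n + 1) (mul 1 n f d)"
  by (simp add: delta_def signed_def gdiff_def)

lemma signed_closed: "x \<in> carrier (A p) \<Longrightarrow> signed n p x \<in> carrier (A p)"
  by (simp add: signed_def)

lemma delta_hom:
  assumes "d \<in> carrier (A 1)" "d' \<in> carrier (A 1)"
  shows "delta d d' n \<in> hom (A n) (A (n + 1))"
proof (rule homI)
  have cl: "mul n 1 d' f \<in> carrier (A (n + 1))" "mul 1 n f d \<in> carrier (A (n + 1))"
    if "f \<in> carrier (A n)" for f
    using assms that by (auto intro: mul_closed)
  show "delta d d' n f \<in> carrier (A (n + 1))" if "f \<in> carrier (A n)" for f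
    using cl[OF that] by (simp add: delta_signed signed_closed)
  show "delta d d' n (f \<otimes>\<^bsub>A n\<^esub> g) = delta d d' n f \<otimes>\<^bsub>A (n + 1)\<^esub> delta d d' n g"
    if "f \<in> carrier (A n)" "g \<in> carrier (A n)" for f g
    using that assms cl mul_mult_left[OF assms(1), of f n g]
    by (simp add: delta_signed signed_def mul_mult_right A.m_ac A.inv_mult add.commute)
qed

lemma delta_mem:
  assumes "d \<in> carrier (A 1)" "d' \<in> carrier (A 1)" "f \<in> I n"
  shows "delta d d' n f \<in> I (n + 1)"
  using I_left[of f n d' 1] I_right[of d 1 f n] assms
  by (simp add: delta_signed signed_def add.commute I_mult I_inv)

end

text \<open>
  A differential modulo the ideal. In the bigroupoid of its lifts, \<open>flat_lifts\<close> are the objects,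
  \<open>intertwiners\<close> the 1-cells and \<open>homotopies\<close> the 2-cells; that intertwiners are isomorphisms of
  complexes is \<open>intertwiner_invertible\<close>.
\<close>

locale lifted_differential = square_zero_ideal +
  fixes d0
  assumes d0_closed: "d0 \<in> carrier (A 1)" and d0_square: "mul 1 1 d0 d0 \<in> I 2"
begin

definition "K n = A n\<lparr>carrier := I n\<rparr>"
definition "D = delta d0 d0"
definition "lifts = I 1 #>\<^bsub>A 1\<^esub> d0"
definition "one_lifts = I 0 #>\<^bsub>A 0\<^esub> e"
definition "flat_lifts = {d \<in> lifts. mul 1 1 d d = \<one>\<^bsub>A 2\<^esub>}"
definition "intertwiners d d' = {u \<in> one_lifts. mul 0 1 d' u = mul 1 0 u d}"
definition "homotopies d d' u u' = {h \<in> I (- 1). delta d d' (- 1) h = gdiff (A 0) u' u}"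

lemma d0_lift: "d0 \<in> lifts"
  unfolding lifts_def by (intro A.rcos_self d0_closed I_subgroup)

lemma lift_closed: "d \<in> lifts \<Longrightarrow> d \<in> carrier (A 1)"
  using A.r_coset_subset_G[OF subgroup.subset[OF I_subgroup] d0_closed] by (auto simp: lifts_def)

lemma one_lift_closed: "u \<in> one_lifts \<Longrightarrow> u \<in> carrier (A 0)"
  using A.r_coset_subset_G[OF subgroup.subset[OF I_subgroup] e_closed]
  by (auto simp: one_lifts_def)

lemma coset_diff:
  assumes "x \<in> carrier (A n)" "y \<in> I n #>\<^bsub>A n\<^esub> x" "z \<in> I n #>\<^bsub>A n\<^esub> x"
  shows "gdiff (A n) z y \<in> I n"
proof -
  have "I n #>\<^bsub>A n\<^esub> y = I n #>\<^bsub>A n\<^esub> z"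
    using A.repr_independence[OF assms(2,1) I_subgroup]
      A.repr_independence[OF assms(3,1) I_subgroup] by simp
  moreover have "y \<in> carrier (A n)" "z \<in> carrier (A n)"
    using assms A.r_coset_subset_G[OF subgroup.subset[OF I_subgroup] assms(1)] by auto
  ultimately show ?thesis by (simp add: rcoset_eq_iff_gdiff[OF A.is_group I_subgroup])
qed

lemma lift_diff: "\<lbrakk>d \<in> lifts; d' \<in> lifts\<rbrakk> \<Longrightarrow> gdiff (A 1) d' d \<in> I 1"
  unfolding lifts_def by (rule coset_diff[OF d0_closed])

lemma one_lift_diff: "\<lbrakk>u \<in> one_lifts; u' \<in> one_lifts\<rbrakk> \<Longrightarrow> gdiff (A 0) u' u \<in> I 0"
  unfolding one_lifts_def by (rule coset_diff[OF e_closed])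

text \<open>
  Two lifts differ by an element of \<open>I\<close>, and the product of that element with \<open>f \<in> I\<close> is zero.
\<close>

lemma delta_lift_indep:
  assumes "d \<in> lifts" "d' \<in> lifts" "f \<in> I n"
  shows "delta d d' n f = D n f"
proof -
  obtain k where k: "k \<in> I 1" "d = k \<otimes>\<^bsub>A 1\<^esub> d0"
    using assms(1) by (auto simp: lifts_def r_coset_def)
  obtain k' where k': "k' \<in> I 1" "d' = k' \<otimes>\<^bsub>A 1\<^esub> d0"
    using assms(2) by (auto simp: lifts_def r_coset_def)
  note c = I_carrier[OF k(1)] I_carrier[OF k'(1)] I_carrier[OF assms(3)] d0_closed
  have "mul n 1 d' f = mul n 1 d0 f"
    using c k' assms(3) by (simp add: mul_mult_left I_square mul_closed)
  moreover have "mul 1 n f d = mul 1 n f d0"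
    using c k assms(3) by (simp add: mul_mult_right I_square mul_closed)
  ultimately show ?thesis by (simp add: delta_signed D_def)
qed

text \<open>
  \<open>\<delta>\<^sup>2 f = d\<^sub>0\<^sup>2 f - f d\<^sub>0\<^sup>2\<close>, where both terms are products of two elements of \<open>I\<close>.
\<close>

lemma D_D_kernel:
  assumes f: "f \<in> I n"
  shows "D (n + 1) (D n f) = \<one>\<^bsub>A (n + 1 + 1)\<^esub>"
proof -
  note fc = I_carrier[OF f]
  \<comment> \<open>The mixed term \<open>m = d\<^sub>0 f d\<^sub>0\<close> occurs twice, with opposite signs.\<close>
  define a where "a = mul n 1 d0 f"
  define b where "b = mul 1 n f d0"
  define m where "m = mul (n + 1) 1 d0 b"
  have a: "a \<in> carrier (A (n + 1))" and b: "b \<in> carrier (A (n + 1))"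
    using fc d0_closed by (auto simp: a_def b_def intro: mul_closed)
  have m: "m \<in> carrier (A (n + 2))" using b d0_closed by (auto simp: m_def intro: mul_closed)
  have da: "mul (n + 1) 1 d0 a = \<one>\<^bsub>A (n + 2)\<^esub>"
    using mul_assoc[OF fc d0_closed d0_closed] I_square[OF f d0_square] by (simp add: a_def)
  have bd: "mul 1 (n + 1) b d0 = \<one>\<^bsub>A (n + 2)\<^esub>"
    using mul_assoc[OF d0_closed d0_closed fc] I_square[OF d0_square f]
    by (simp add: b_def add.commute)
  have ad: "mul 1 (n + 1) a d0 = m"
    using mul_assoc[OF d0_closed fc d0_closed] by (simp add: a_def b_def m_def add.commute)
  have c: "1 + (n + 1) = n + 2" "n + 1 + 1 = n + 2" by simp_all
  have "D (n + 1) (a \<otimes>\<^bsub>A (n + 1)\<^esub> signed n (n + 1) b) = \<one>\<^bsub>A (n + 2)\<^esub>"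
    using a b m d0_closed mul_mult_right[OF d0_closed, of a "n + 1"]
      mul_inv_right[OF d0_closed, of b "n + 1"] mul_mult_left[OF d0_closed, of a "n + 1"]
      mul_inv_left[OF d0_closed, of b "n + 1"]
    by (simp add: D_def delta_signed signed_def c da bd ad m_def[symmetric])
  then show ?thesis by (simp add: c D_def delta_signed[of _ _ n] a_def b_def)
qed

sublocale cochain_groups K D
proof (rule cochain_groups.intro)
  show "comm_group (K n)" for n
    unfolding K_def using subgroup.subgroup_is_group[OF I_subgroup A.is_group]
    by (rule group.group_comm_groupI) (simp add: A.m_comm I_carrier)
  show "D n \<in> hom (K n) (K (n + 1))" for n
    using delta_hom[OF d0_closed d0_closed] delta_mem[OF d0_closed d0_closed]
    by (auto simp: hom_def K_def D_def I_carrier)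
  show "D (n + 1) (D n f) = \<one>\<^bsub>K (n + 1 + 1)\<^esub>" if "f \<in> carrier (K n)" for n f
    using that D_D_kernel by (simp add: K_def)
qed

lemma cocycle_iff: "z \<in> carrier (cocycles K D n) \<longleftrightarrow> z \<in> I n \<and> D n z = \<one>\<^bsub>A (n + 1)\<^esub>"
  by (auto simp: cocycles_def K_def)

lemma coboundary_iff: "b \<in> coboundaries K D n \<longleftrightarrow> (\<exists>k\<in>I (n - 1). D (n - 1) k = b)"
  by (auto simp: coboundaries_def K_def)

text \<open>
  \<open>(k + d)\<^sup>2 = k\<^sup>2 + (d k + k d) + d\<^sup>2\<close>, and \<open>k\<^sup>2 = 0\<close>.
\<close>

lemma square_translate:
  assumes d: "d \<in> lifts" and k: "k \<in> I 1"
  shows "mul 1 1 (k \<otimes>\<^bsub>A 1\<^esub> d) (k \<otimes>\<^bsub>A 1\<^esub> d) = D 1 k \<otimes>\<^bsub>A 2\<^esub> mul 1 1 d d"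
proof -
  note c = lift_closed[OF d] I_carrier[OF k]
  have "mul 1 1 x y \<in> carrier (A 2)" if "x \<in> carrier (A 1)" "y \<in> carrier (A 1)" for x y
    using that by (auto intro: mul_closed)
  moreover have "mul 1 1 k k = \<one>\<^bsub>A 2\<^esub>" using I_square[OF k k] by simp
  moreover have "D 1 k \<in> carrier (A 2)"
    using delta_mem[OF d0_closed d0_closed k] by (simp add: D_def I_carrier)
  ultimately show ?thesis
    using c mul_mult_left[of "k \<otimes>\<^bsub>A 1\<^esub> d" 1 k 1 d] mul_mult_right[of k 1 k 1 d]
      mul_mult_right[of d 1 k 1 d] delta_lift_indep[OF d d k]
    by (simp add: delta_signed signed_def A.m_ac)
qed

lemma translate_lift: "\<lbrakk>d \<in> lifts; k \<in> I 1\<rbrakk> \<Longrightarrow> k \<otimes>\<^bsub>A 1\<^esub> d \<in> lifts"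
  using I_mult I_carrier d0_closed by (auto simp: lifts_def r_coset_def simp flip: A.m_assoc)

lemma lift_decompose:
  assumes "d \<in> lifts" "d' \<in> lifts"
  obtains k where "k \<in> I 1" "d' = k \<otimes>\<^bsub>A 1\<^esub> d" "k = gdiff (A 1) d' d"
  using lift_diff[OF assms] gdiff_mult_cancel[OF A.is_group, of d' 1 d] lift_closed assms by metis

lemma gdiff_K: "\<lbrakk>x \<in> I n; y \<in> I n\<rbrakk> \<Longrightarrow> gdiff (K n) x y = gdiff (A n) x y"
  using A.m_inv_consistent[OF I_subgroup] by (simp add: gdiff_def K_def)

text \<open>
  Computing \<open>\<delta>\<close> with \<open>d\<close> itself instead of \<open>d\<^sub>0\<close> gives \<open>\<delta> (d\<^sup>2) = d d\<^sup>2 - d\<^sup>2 d = 0\<close>.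
\<close>

lemma square_cocycle:
  assumes d: "d \<in> lifts"
  shows "mul 1 1 d d \<in> carrier (cocycles K D 2)"
proof -
  obtain k where k: "k \<in> I 1" "d = k \<otimes>\<^bsub>A 1\<^esub> d0" using lift_decompose[OF d0_lift d] by metis
  have "D 1 k \<in> I 2" using delta_mem[OF d0_closed d0_closed k(1)] by (simp add: D_def)
  then have I: "mul 1 1 d d \<in> I 2"
    using square_translate[OF d0_lift k(1)] k(2) d0_square I_mult by simp
  note c = lift_closed[OF d]
  have "D 2 (mul 1 1 d d) = delta d d 2 (mul 1 1 d d)"
    using delta_lift_indep[OF d d I] by simp
  also have "\<dots> = \<one>\<^bsub>A 3\<^esub>"
    using mul_assoc[OF c c c] mul_closed[OF I_carrier[OF I] c, of 3]
    by (simp add: delta_def gdiff_def)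
  finally show ?thesis using I by (simp add: cocycle_iff)
qed

lemma square_class_indep:
  assumes "d \<in> lifts" "d' \<in> lifts"
  shows "cohomology_class K D 2 (mul 1 1 d d) = cohomology_class K D 2 (mul 1 1 d' d')"
proof -
  obtain k where k: "k \<in> I 1" "d' = k \<otimes>\<^bsub>A 1\<^esub> d" using lift_decompose[OF assms] by metis
  have "mul 1 1 d d \<in> I 2" "mul 1 1 d' d' \<in> I 2"
    using square_cocycle assms by (auto simp: cocycle_iff)
  moreover have "D 1 k \<in> I 2" using delta_mem[OF d0_closed d0_closed k(1)] by (simp add: D_def)
  moreover have "mul 1 1 d' d' = D 1 k \<otimes>\<^bsub>A 2\<^esub> mul 1 1 d d"
    using square_translate[OF assms(1) k(1)] k(2) by simp
  ultimately have "gdiff (K 2) (mul 1 1 d' d') (mul 1 1 d d) = D 1 k"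
    using I_carrier by (simp add: gdiff_K gdiff_eq_iff A.is_group)
  then show ?thesis
    using k(1) assms square_cocycle cohomology_class_eq_iff by (auto simp: coboundary_iff)
qed

text \<open>
  If \<open>d\<^sub>0\<^sup>2 = \<delta> k\<close>, the corrected lift \<open>d\<^sub>0 - k\<close> has square zero.
\<close>

lemma obstruction_vanishes_iff:
  "cohomology_class K D 2 (mul 1 1 d0 d0) = \<one>\<^bsub>cohomology K D 2\<^esub> \<longleftrightarrow> flat_lifts \<noteq> {}"
proof
  assume "cohomology_class K D 2 (mul 1 1 d0 d0) = \<one>\<^bsub>cohomology K D 2\<^esub>"
  then obtain k where k: "k \<in> I 1" "D 1 k = mul 1 1 d0 d0"
    using square_cocycle[OF d0_lift] by (auto simp: cohomology_class_eq_one_iff coboundary_iff)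
  have "D 1 (inv\<^bsub>A 1\<^esub> k) = inv\<^bsub>A 2\<^esub> D 1 k"
    using group_hom.hom_inv[of "A 1" "A 2" "D 1"] delta_hom[OF d0_closed d0_closed, of 1]
      I_carrier[OF k(1)]
    by (simp add: D_def group_hom_def group_hom_axioms_def A.is_group)
  then have "mul 1 1 (inv\<^bsub>A 1\<^esub> k \<otimes>\<^bsub>A 1\<^esub> d0) (inv\<^bsub>A 1\<^esub> k \<otimes>\<^bsub>A 1\<^esub> d0) = \<one>\<^bsub>A 2\<^esub>"
    using square_translate[OF d0_lift I_inv[OF k(1)]] k(2) I_carrier[OF d0_square] by simp
  then show "flat_lifts \<noteq> {}"
    using translate_lift[OF d0_lift I_inv[OF k(1)]] by (auto simp: flat_lifts_def)
next
  assume "flat_lifts \<noteq> {}"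
  then obtain d where d: "d \<in> lifts" "mul 1 1 d d = \<one>\<^bsub>A 2\<^esub>" by (auto simp: flat_lifts_def)
  have "\<one>\<^bsub>A 2\<^esub> \<in> coboundaries K D 2"
    using subgroup.one_closed[OF coboundaries_subgroup, of 2] by (simp add: K_def)
  then have "cohomology_class K D 2 (mul 1 1 d d) = \<one>\<^bsub>cohomology K D 2\<^esub>"
    using d square_cocycle[OF d(1)] by (simp add: cohomology_class_eq_one_iff)
  then show "cohomology_class K D 2 (mul 1 1 d0 d0) = \<one>\<^bsub>cohomology K D 2\<^esub>"
    using square_class_indep[OF d0_lift d(1)] by simp
qed

text \<open>
  By \<open>square_translate\<close>, adding \<open>k\<close> to a square-zero lift changes its square by \<open>\<delta> k\<close>.
\<close>

lemma flat_lifts_coset: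
  assumes d: "d \<in> flat_lifts"
  shows "flat_lifts = carrier (cocycles K D 1) #>\<^bsub>A 1\<^esub> d"
proof -
  have dl: "d \<in> lifts" and sq: "mul 1 1 d d = \<one>\<^bsub>A 2\<^esub>" using d by (auto simp: flat_lifts_def)
  have *: "k \<otimes>\<^bsub>A 1\<^esub> d \<in> flat_lifts \<longleftrightarrow> D 1 k = \<one>\<^bsub>A 2\<^esub>" if k: "k \<in> I 1" for k
    using square_translate[OF dl k] translate_lift[OF dl k] sq I_carrier[of "D 1 k" 2]
      delta_mem[OF d0_closed d0_closed k]
    by (simp add: flat_lifts_def D_def)
  show ?thesis
  proof (intro equalityI subsetI)
    fix d' assume d': "d' \<in> flat_lifts"
    then have "d' \<in> lifts" by (simp add: flat_lifts_def)
    then obtain k where "k \<in> I 1" "d' = k \<otimes>\<^bsub>A 1\<^esub> d" using lift_decompose[OF dl] by metis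
    with d' * show "d' \<in> carrier (cocycles K D 1) #>\<^bsub>A 1\<^esub> d"
      by (auto simp: r_coset_def cocycle_iff)
  qed (auto simp: r_coset_def cocycle_iff *)
qed

lemma one_lift_decompose:
  assumes "u \<in> one_lifts" "u' \<in> one_lifts"
  obtains h where "h \<in> I 0" "u' = h \<otimes>\<^bsub>A 0\<^esub> u" "h = gdiff (A 0) u' u"
  using one_lift_diff[OF assms] gdiff_mult_cancel[OF A.is_group, of u' 0 u] one_lift_closed assms
  by metis

lemma translate_one_lift: "\<lbrakk>u \<in> one_lifts; h \<in> I 0\<rbrakk> \<Longrightarrow> h \<otimes>\<^bsub>A 0\<^esub> u \<in> one_lifts"
  using I_mult I_carrier e_closed
  by (auto simp: one_lifts_def r_coset_def simp flip: A.m_assoc)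

lemma e_one_lift: "e \<in> one_lifts"
  unfolding one_lifts_def by (intro A.rcos_self e_closed I_subgroup)

lemma D_0_mem: "h \<in> I 0 \<Longrightarrow> D 0 h \<in> carrier (A 1)"
  using delta_mem[OF d0_closed d0_closed, of h 0] by (simp add: D_def I_carrier)

text \<open>
  The defect of \<open>u\<close> to commute with the differentials changes by \<open>d' h - h d\<close>, which is \<open>\<delta> h\<close> since
  \<open>h \<in> I\<close>. The cases \<open>u = 1\<close> and \<open>u\<close> an intertwiner describe all intertwiners.
\<close>

lemma commutator_translate:
  assumes d: "d \<in> lifts" and d': "d' \<in> lifts" and u: "u \<in> one_lifts" and h: "h \<in> I 0"
  shows "gdiff (A 1) (mul 0 1 d' (h \<otimes>\<^bsub>A 0\<^esub> u)) (mul 1 0 (h \<otimes>\<^bsub>A 0\<^esub> u) d) =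
    D 0 h \<otimes>\<^bsub>A 1\<^esub> gdiff (A 1) (mul 0 1 d' u) (mul 1 0 u d)"
proof -
  note c = lift_closed[OF d] lift_closed[OF d'] one_lift_closed[OF u] I_carrier[OF h]
  have "mul 0 1 x y \<in> carrier (A 1)" "mul 1 0 y x \<in> carrier (A 1)"
    if "x \<in> carrier (A 1)" "y \<in> carrier (A 0)" for x y
    using that by (auto intro: mul_closed)
  then show ?thesis
    using c mul_mult_right[of d' 1 h 0 u] mul_mult_left[of d 1 h 0 u]
      delta_lift_indep[OF d d' h, symmetric]
    by (simp add: delta_def gdiff_def A.m_ac A.inv_mult)
qed

lemma intertwiner_iff:
  assumes "d \<in> lifts" "d' \<in> lifts" "u \<in> one_lifts"
  shows "u \<in> intertwiners d d' \<longleftrightarrow> gdiff (A 1) (mul 0 1 d' u) (mul 1 0 u d) = \<one>\<^bsub>A 1\<^esub>"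
  using assms lift_closed one_lift_closed
  by (subst gdiff_eq_iff) (auto simp: intertwiners_def A.is_group mul_closed)

lemma translate_e_intertwiner_iff:
  assumes d: "d \<in> lifts" and d': "d' \<in> lifts" and h: "h \<in> I 0"
  shows "h \<otimes>\<^bsub>A 0\<^esub> e \<in> intertwiners d d' \<longleftrightarrow> D 0 h = gdiff (A 1) d d'"
proof -
  note c = lift_closed[OF d] lift_closed[OF d'] D_0_mem[OF h]
  have "h \<otimes>\<^bsub>A 0\<^esub> e \<in> intertwiners d d' \<longleftrightarrow> D 0 h \<otimes>\<^bsub>A 1\<^esub> gdiff (A 1) d' d = \<one>\<^bsub>A 1\<^esub>"
    using commutator_translate[OF d d' e_one_lift h] c
      intertwiner_iff[OF d d' translate_one_lift[OF e_one_lift h]]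
    by (simp add: e_left e_right)
  also have "\<dots> \<longleftrightarrow> D 0 h = inv\<^bsub>A 1\<^esub> gdiff (A 1) d' d"
    using c gdiff_closed[OF A.is_group] A.inv_equality A.l_inv by metis
  also have "inv\<^bsub>A 1\<^esub> gdiff (A 1) d' d = gdiff (A 1) d d'"
    using c by (simp add: gdiff_def A.inv_mult A.m_comm)
  finally show ?thesis .
qed

lemma D_0_inv: "h \<in> I 0 \<Longrightarrow> D 0 (inv\<^bsub>A 0\<^esub> h) = inv\<^bsub>A 1\<^esub> D 0 h"
  using group_hom.hom_inv[of "A 0" "A 1" "D 0"] delta_hom[OF d0_closed d0_closed, of 0]
  by (simp add: I_carrier D_def group_hom_def group_hom_axioms_def A.is_group)

text \<open>
  Conjugation with \<open>h + 1\<close> takes \<open>d\<close> to \<open>d - \<delta> h\<close>. Replacing \<open>h\<close> by \<open>-h\<close> accounts for the sign.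
\<close>

lemma intertwiners_nonempty_iff:
  assumes d: "d \<in> lifts" and d': "d' \<in> lifts"
  shows "intertwiners d d' \<noteq> {} \<longleftrightarrow> gdiff (A 1) d' d \<in> coboundaries K D 1"
proof -
  have inv: "inv\<^bsub>A 1\<^esub> gdiff (A 1) x y = gdiff (A 1) y x" if "x \<in> lifts" "y \<in> lifts" for x y
    using that lift_closed by (simp add: gdiff_def A.inv_mult A.m_comm)
  have "intertwiners d d' \<noteq> {} \<longleftrightarrow> (\<exists>h\<in>I 0. h \<otimes>\<^bsub>A 0\<^esub> e \<in> intertwiners d d')"
    by (auto simp: intertwiners_def one_lifts_def r_coset_def)
  also have "\<dots> \<longleftrightarrow> (\<exists>h\<in>I 0. D 0 h = gdiff (A 1) d d')"
    by (simp add: translate_e_intertwiner_iff[OF d d'])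
  also have "\<dots> \<longleftrightarrow> (\<exists>h\<in>I 0. D 0 h = gdiff (A 1) d' d)"
    using I_inv D_0_inv inv[OF d d'] inv[OF d' d] by metis
  finally show ?thesis by (simp add: coboundary_iff)
qed

text \<open>
  As \<open>h\<^sup>2 = 0\<close>, the inverse of \<open>h + 1\<close> is \<open>-h + 1\<close>; it intertwines in the other direction because
  \<open>\<delta> (-h) = d' - d\<close>.
\<close>

lemma intertwiner_invertible:
  assumes d: "d \<in> lifts" and d': "d' \<in> lifts" and u: "u \<in> intertwiners d d'"
  obtains g where "g \<in> intertwiners d' d" "mul 0 0 g u = e" "mul 0 0 u g = e"
proof -
  obtain h where h: "h \<in> I 0" "u = h \<otimes>\<^bsub>A 0\<^esub> e"
    using u by (auto simp: intertwiners_def one_lifts_def r_coset_def)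
  define g where "g = inv\<^bsub>A 0\<^esub> h \<otimes>\<^bsub>A 0\<^esub> e"
  note c = I_carrier[OF h(1)] e_closed
  have "inv\<^bsub>A 1\<^esub> gdiff (A 1) d d' = gdiff (A 1) d' d"
    using d d' lift_closed by (simp add: gdiff_def A.inv_mult A.m_comm)
  then have "g \<in> intertwiners d' d"
    using u h translate_e_intertwiner_iff[OF d d' h(1)]
      translate_e_intertwiner_iff[OF d' d I_inv[OF h(1)]]
    by (simp add: g_def D_0_inv)
  moreover have mul: "mul 0 0 (x \<otimes>\<^bsub>A 0\<^esub> e) (y \<otimes>\<^bsub>A 0\<^esub> e) = x \<otimes>\<^bsub>A 0\<^esub> y \<otimes>\<^bsub>A 0\<^esub> e"
    if "x \<in> I 0" "y \<in> I 0" for x y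
    using that I_carrier[OF that(1)] I_carrier[OF that(2)] e_closed I_square[OF that(2,1)]
      mul_mult_left[of "y \<otimes>\<^bsub>A 0\<^esub> e" 0 x 0 e] mul_mult_right[of x 0 y 0 e]
    by (simp add: e_left e_right A.m_assoc)
  moreover have "mul 0 0 g u = e" "mul 0 0 u g = e"
    using mul[OF I_inv[OF h(1)] h(1)] mul[OF h(1) I_inv[OF h(1)]] c
    by (simp_all add: g_def h(2))
  ultimately show ?thesis using that by blast
qed

lemma intertwiners_coset:
  assumes d: "d \<in> lifts" and d': "d' \<in> lifts" and u: "u \<in> intertwiners d d'"
  shows "intertwiners d d' = carrier (cocycles K D 0) #>\<^bsub>A 0\<^esub> u"
proof -
  have ul: "u \<in> one_lifts" using u by (simp add: intertwiners_def)
  have *: "h \<otimes>\<^bsub>A 0\<^esub> u \<in> intertwiners d d' \<longleftrightarrow> D 0 h = \<one>\<^bsub>A 1\<^esub>" if h: "h \<in> I 0" for h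
    using commutator_translate[OF d d' ul h] u intertwiner_iff[OF d d'] D_0_mem[OF h] ul
      translate_one_lift[OF ul h] by simp
  show ?thesis
  proof (intro equalityI subsetI)
    fix u' assume u': "u' \<in> intertwiners d d'"
    then have "u' \<in> one_lifts" by (simp add: intertwiners_def)
    then obtain h where "h \<in> I 0" "u' = h \<otimes>\<^bsub>A 0\<^esub> u" using one_lift_decompose[OF ul] by metis
    with u' * show "u' \<in> carrier (cocycles K D 0) #>\<^bsub>A 0\<^esub> u"
      by (auto simp: r_coset_def cocycle_iff)
  qed (auto simp: r_coset_def cocycle_iff *)
qed

lemma homotopies_nonempty_iff:
  assumes "d \<in> lifts" "d' \<in> lifts"
  shows "homotopies d d' u u' \<noteq> {} \<longleftrightarrow> gdiff (A 0) u' u \<in> coboundaries K D 0"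
  using delta_lift_indep[OF assms, of _ "-1"] by (auto simp: homotopies_def coboundary_iff)

lemma cohomology_eq: "cohomology K D n = A n\<lparr>carrier := carrier (cocycles K D n)\<rparr> Mod coboundaries K D n"
  by (simp add: cohomology_def cocycles_def K_def)

lemma cohomology_class_eq: "cohomology_class K D n z =
    coboundaries K D n #>\<^bsub>A n\<lparr>carrier := carrier (cocycles K D n)\<rparr>\<^esub> z"
  by (simp add: cohomology_class_def cocycles_def K_def)

lemma cohomology_coset_pair:
  assumes "x \<in> carrier (A n)"
  shows "coset_pair (A n) (carrier (cocycles K D n)) (coboundaries K D n) x
    (carrier (cocycles K D n) #>\<^bsub>A n\<^esub> x)"
proof -
  have sub: "subgroup H (A n)" if "subgroup H (K n)" for H
    using that A.incl_subgroup[OF I_subgroup] by (simp add: K_def)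
  show ?thesis
    using assms sub cocycles_subgroup coboundaries_subgroup coboundaries_le_cocycles
    by (simp add: coset_pair_def coset_pair_axioms_def A_comm_group)
qed

theorem flat_lifts_torsor:
  assumes "flat_lifts \<noteq> {}"
  defines "v \<equiv> \<lambda>d d'. cohomology_class K D 1 (gdiff (A 1) d' d)"
  shows "\<lbrakk>d \<in> flat_lifts; d' \<in> flat_lifts\<rbrakk> \<Longrightarrow> v d d' \<in> carrier (cohomology K D 1)"
    and "\<lbrakk>d \<in> flat_lifts; d' \<in> flat_lifts\<rbrakk> \<Longrightarrow> v d d' = \<one>\<^bsub>cohomology K D 1\<^esub> \<longleftrightarrow>
      sk_class flat_lifts intertwiners d = sk_class flat_lifts intertwiners d'"
    and "\<lbrakk>d \<in> flat_lifts; d' \<in> flat_lifts\<rbrakk> \<Longrightarrow> v d d' = \<one>\<^bsub>cohomology K D 1\<^esub> \<longleftrightarrow>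
      intertwiners d d' \<noteq> {}"
    and "induces_affine_structure (cohomology K D 1) (Sk flat_lifts intertwiners) flat_lifts
      (sk_class flat_lifts intertwiners) v"
proof -
  obtain x where x: "x \<in> flat_lifts" using assms by blast
  have fl: "d \<in> lifts" if "d \<in> flat_lifts" for d using that by (simp add: flat_lifts_def)
  interpret coset_pair "A 1" "carrier (cocycles K D 1)" "coboundaries K D 1" x flat_lifts
    using cohomology_coset_pair[OF lift_closed[OF fl[OF x]]] flat_lifts_coset[OF x] by simp
  note cells = intertwiners_nonempty_iff[OF fl fl]
  show "\<lbrakk>d \<in> flat_lifts; d' \<in> flat_lifts\<rbrakk> \<Longrightarrow> v d d' \<in> carrier (cohomology K D 1)"
    unfolding v_def cohomology_class_eq cohomology_eq using cells by (rule difference_class(1))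
  show "\<lbrakk>d \<in> flat_lifts; d' \<in> flat_lifts\<rbrakk> \<Longrightarrow> v d d' = \<one>\<^bsub>cohomology K D 1\<^esub> \<longleftrightarrow>
      sk_class flat_lifts intertwiners d = sk_class flat_lifts intertwiners d'"
    unfolding v_def cohomology_class_eq cohomology_eq using cells by (rule difference_class(2))
  show "\<lbrakk>d \<in> flat_lifts; d' \<in> flat_lifts\<rbrakk> \<Longrightarrow> v d d' = \<one>\<^bsub>cohomology K D 1\<^esub> \<longleftrightarrow>
      intertwiners d d' \<noteq> {}"
    unfolding v_def cohomology_class_eq cohomology_eq
    using cells difference_class(3)[of intertwiners d d'] by simp
  show "induces_affine_structure (cohomology K D 1) (Sk flat_lifts intertwiners) flat_lifts
      (sk_class flat_lifts intertwiners) v"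
    unfolding v_def cohomology_class_eq cohomology_eq using cells by (rule induces_affine)
qed

theorem intertwiners_torsor:
  assumes d: "d \<in> lifts" and d': "d' \<in> lifts" and ne: "intertwiners d d' \<noteq> {}"
  defines "U \<equiv> intertwiners d d'" and "T \<equiv> homotopies d d'"
    and "w \<equiv> \<lambda>u u'. cohomology_class K D 0 (gdiff (A 0) u' u)"
  shows "\<lbrakk>u \<in> U; u' \<in> U\<rbrakk> \<Longrightarrow> w u u' \<in> carrier (cohomology K D 0)"
    and "\<lbrakk>u \<in> U; u' \<in> U\<rbrakk> \<Longrightarrow>
      w u u' = \<one>\<^bsub>cohomology K D 0\<^esub> \<longleftrightarrow> sk_class U T u = sk_class U T u'"
    and "induces_affine_structure (cohomology K D 0) (Sk U T) U (sk_class U T) w"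
proof -
  obtain x where x: "x \<in> U" using ne by (auto simp: U_def)
  then have "x \<in> carrier (A 0)" by (simp add: U_def intertwiners_def one_lift_closed)
  then interpret coset_pair "A 0" "carrier (cocycles K D 0)" "coboundaries K D 0" x U
    using cohomology_coset_pair[of x 0] intertwiners_coset[OF d d', of x] x by (simp add: U_def)
  have cells: "T u u' \<noteq> {} \<longleftrightarrow> gdiff (A 0) u' u \<in> coboundaries K D 0" for u u'
    unfolding T_def by (rule homotopies_nonempty_iff[OF d d'])
  show "\<lbrakk>u \<in> U; u' \<in> U\<rbrakk> \<Longrightarrow> w u u' \<in> carrier (cohomology K D 0)"
    unfolding w_def cohomology_class_eq cohomology_eq using cells by (rule difference_class(1))
  show "\<lbrakk>u \<in> U; u' \<in> U\<rbrakk> \<Longrightarrow>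
      w u u' = \<one>\<^bsub>cohomology K D 0\<^esub> \<longleftrightarrow> sk_class U T u = sk_class U T u'"
    unfolding w_def cohomology_class_eq cohomology_eq using cells by (rule difference_class(2))
  show "induces_affine_structure (cohomology K D 0) (Sk U T) U (sk_class U T) w"
    unfolding w_def cohomology_class_eq cohomology_eq using cells by (rule induces_affine)
qed

end


section \<open>Graded maps in linear categories\<close>

lemma mem_ghom: "f \<in> carrier (ghom C X Y n) \<longleftrightarrow> (\<forall>i. f i \<in> carrier (Hom C (X i) (Y (i + n))))"
  by (auto simp: ghom_def)

lemma ghom_mult: "f \<otimes>\<^bsub>ghom C X Y n\<^esub> g = (\<lambda>i. f i \<oplus>\<^bsub>Hom C (X i) (Y (i + n))\<^esub> g i)"
  by (simp add: ghom_def fun_eq_iff)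

lemma ghom_one: "\<one>\<^bsub>ghom C X Y n\<^esub> = (\<lambda>i. \<zero>\<^bsub>Hom C (X i) (Y (i + n))\<^esub>)"
  by (simp add: ghom_def fun_eq_iff)

context linear_category
begin

lemma ghom_comm_group:
  assumes "graded_object C X" "graded_object C Y"
  shows "comm_group (ghom C X Y n)"
proof -
  have hom: "comm_group (add_monoid (Hom C (X i) (Y (i + n))))" for i
    using hom_module assms module.axioms(2) abelian_group.a_comm_group
    unfolding graded_object_def by blast
  have "group (ghom C X Y n)"
    using hom comm_group.axioms unfolding ghom_def by (intro product_group) blast
  moreover have "f \<otimes>\<^bsub>ghom C X Y n\<^esub> g = g \<otimes>\<^bsub>ghom C X Y n\<^esub> f"
    if "f \<in> carrier (ghom C X Y n)" "g \<in> carrier (ghom C X Y n)" for f g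
    using that comm_monoid.m_comm[OF comm_group.axioms(1)[OF hom]]
    by (simp add: ghom_mult mem_ghom)
  ultimately show ?thesis by (rule group.group_comm_groupI)
qed

lemma gcomp_closed:
  assumes "graded_object C X" "graded_object C Y" "graded_object C Z"
    and "f \<in> carrier (ghom C X Y m)" "g \<in> carrier (ghom C Y Z n)" "p = m + n"
  shows "gcomp C X Y Z m n g f \<in> carrier (ghom C X Z p)"
  using assms
  by (auto simp: mem_ghom gcomp_def graded_object_def add.assoc[symmetric] intro!: cmp_closed)

lemma gcomp_hom_right:
  assumes "graded_object C X" "graded_object C Y" "graded_object C Z"
    and g: "g \<in> carrier (ghom C Y Z n)"
  shows "gcomp C X Y Z m n g \<in> hom (ghom C X Y m) (ghom C X Z (m + n))"
proof (rule homI)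
  show "gcomp C X Y Z m n g f \<in> carrier (ghom C X Z (m + n))"
    if "f \<in> carrier (ghom C X Y m)" for f
    using gcomp_closed assms that by simp
  show "gcomp C X Y Z m n g (f \<otimes>\<^bsub>ghom C X Y m\<^esub> f') =
      gcomp C X Y Z m n g f \<otimes>\<^bsub>ghom C X Z (m + n)\<^esub> gcomp C X Y Z m n g f'"
    if "f \<in> carrier (ghom C X Y m)" "f' \<in> carrier (ghom C X Y m)" for f f'
    using assms that
    by (simp add: mem_ghom ghom_mult gcomp_def graded_object_def cmp_add_right add.assoc[symmetric])
qed

lemma gcomp_hom_left:
  assumes "graded_object C X" "graded_object C Y" "graded_object C Z"
    and f: "f \<in> carrier (ghom C X Y m)"
  shows "(\<lambda>g. gcomp C X Y Z m n g f) \<in> hom (ghom C Y Z n) (ghom C X Z (m + n))"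
proof (rule homI)
  show "gcomp C X Y Z m n g f \<in> carrier (ghom C X Z (m + n))"
    if "g \<in> carrier (ghom C Y Z n)" for g
    using gcomp_closed assms that by simp
  show "gcomp C X Y Z m n (g \<otimes>\<^bsub>ghom C Y Z n\<^esub> g') f =
      gcomp C X Y Z m n g f \<otimes>\<^bsub>ghom C X Z (m + n)\<^esub> gcomp C X Y Z m n g' f"
    if "g \<in> carrier (ghom C Y Z n)" "g' \<in> carrier (ghom C Y Z n)" for g g'
    using assms that
    by (simp add: mem_ghom ghom_mult gcomp_def graded_object_def cmp_add_left add.assoc[symmetric])
qed

lemma gcomp_one_right:
  assumes "graded_object C X" "graded_object C Y" "graded_object C Z"
    and "g \<in> carrier (ghom C Y Z n)"
  shows "gcomp C X Y Z m n g \<one>\<^bsub>ghom C X Y m\<^esub> = \<one>\<^bsub>ghom C X Z (m + n)\<^esub>"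
  using group_hom.hom_one[of "ghom C X Y m" "ghom C X Z (m + n)" "gcomp C X Y Z m n g"]
    gcomp_hom_right[OF assms] assms
    comm_group.axioms(2)[OF ghom_comm_group]
  by (simp add: group_hom_def group_hom_axioms_def)

lemma gcomp_one_left:
  assumes "graded_object C X" "graded_object C Y" "graded_object C Z"
    and "f \<in> carrier (ghom C X Y m)"
  shows "gcomp C X Y Z m n \<one>\<^bsub>ghom C Y Z n\<^esub> f = \<one>\<^bsub>ghom C X Z (m + n)\<^esub>"
  using group_hom.hom_one[of "ghom C Y Z n" "ghom C X Z (m + n)" "\<lambda>g. gcomp C X Y Z m n g f"]
    gcomp_hom_left[OF assms] assms
    comm_group.axioms(2)[OF ghom_comm_group]
  by (simp add: group_hom_def group_hom_axioms_def)

lemma gcomp_assoc: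
  assumes "graded_object C W" "graded_object C X" "graded_object C Y" "graded_object C Z"
    and "f \<in> carrier (ghom C W X m)" "g \<in> carrier (ghom C X Y n)" "h \<in> carrier (ghom C Y Z p)"
  shows "gcomp C W Y Z (m + n) p h (gcomp C W X Y m n g f) =
    gcomp C W X Z m (n + p) (gcomp C X Y Z n p h g) f"
  using assms
  by (simp add: mem_ghom gcomp_def graded_object_def cmp_assoc add.assoc[symmetric])

lemma gident_closed: "graded_object C X \<Longrightarrow> gident C X \<in> carrier (ghom C X X 0)"
  by (simp add: mem_ghom gident_def graded_object_def ident_closed)

lemma gcomp_ident_right:
  "\<lbrakk>graded_object C X; graded_object C Y; f \<in> carrier (ghom C X Y n)\<rbrakk>
    \<Longrightarrow> gcomp C X X Y 0 n f (gident C X) = f"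
  by (simp add: mem_ghom gcomp_def gident_def graded_object_def ident_right)

lemma gcomp_ident_left:
  "\<lbrakk>graded_object C X; graded_object C Y; f \<in> carrier (ghom C X Y n)\<rbrakk>
    \<Longrightarrow> gcomp C X Y Y n 0 (gident C Y) f = f"
  by (simp add: mem_ghom gcomp_def gident_def graded_object_def ident_left)

lemma graded_iso_cancel_right:
  assumes X: "graded_object C X" and Y: "graded_object C Y" and Z: "graded_object C Z"
    and c: "graded_iso C X Y c" and f: "f \<in> carrier (ghom C Y Z n)"
    and g: "g \<in> carrier (ghom C Y Z n)"
    and eq: "gcomp C X Y Z 0 n f c = gcomp C X Y Z 0 n g c"
  shows "f = g"
proof -
  obtain b where b: "b \<in> carrier (ghom C Y X 0)" "gcomp C Y X Y 0 0 c b = gident C Y"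
    and cc: "c \<in> carrier (ghom C X Y 0)"
    using c by (auto simp: graded_iso_def)
  have "gcomp C Y X Z 0 n (gcomp C X Y Z 0 n x c) b = x" if "x \<in> carrier (ghom C Y Z n)" for x
    using gcomp_assoc[OF Y X Y Z b(1) cc that] b(2) gcomp_ident_right[OF Y Z that] by simp
  with f g eq show ?thesis by metis
qed

end

locale linear_functor =
  CB: linear_category R CB + C: linear_category S C + additive_functor CB C F
  for R :: "'r ring" and S :: "'s ring" and CB :: "('o1, 'r, 'm1) lincat"
    and C :: "('o2, 's, 'm2) lincat" and F :: "('o1, 'm1, 'o2, 'm2) functor_data"
begin

lemma fgob_object: "graded_object CB X \<Longrightarrow> graded_object C (fgob F X)"
  by (simp add: graded_object_def fgob_def fob_closed)

lemma fgmor_hom: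
  assumes "graded_object CB X" "graded_object CB Y"
  shows "fgmor F X Y n \<in> hom (ghom CB X Y n) (ghom C (fgob F X) (fgob F Y) n)"
  using assms
  by (intro homI) (simp_all add: mem_ghom ghom_mult fgmor_def fgob_def graded_object_def
      fmor_closed fmor_add)

lemma fgmor_group_hom:
  assumes "graded_object CB X" "graded_object CB Y"
  shows "group_hom (ghom CB X Y n) (ghom C (fgob F X) (fgob F Y) n) (fgmor F X Y n)"
  using fgmor_hom assms CB.ghom_comm_group C.ghom_comm_group fgob_object
  by (simp add: group_hom_def group_hom_axioms_def comm_group.axioms)

lemma fgmor_gcomp:
  assumes "graded_object CB X" "graded_object CB Y" "graded_object CB Z"
    and "f \<in> carrier (ghom CB X Y m)" "g \<in> carrier (ghom CB Y Z n)" "p = m + n"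
  shows "fgmor F X Z p (gcomp CB X Y Z m n g f) =
    gcomp C (fgob F X) (fgob F Y) (fgob F Z) m n (fgmor F Y Z n g) (fgmor F X Y m f)"
  using assms
  by (simp add: mem_ghom gcomp_def fgmor_def fgob_def graded_object_def fmor_cmp add.assoc[symmetric])

lemma fgmor_gident:
  "graded_object CB X \<Longrightarrow> fgmor F X X 0 (gident CB X) = gident C (fgob F X)"
  by (simp add: fgmor_def gident_def fgob_def graded_object_def fmor_ident)

text \<open>
  A graded map is a family without conditions between its members, so fullness applies in each
  degree separately.
\<close>

lemma fgmor_full:
  assumes "full_functor CB C F" "graded_object CB X" "graded_object CB Y"
    and f: "f \<in> carrier (ghom C (fgob F X) (fgob F Y) n)"
  obtains fB where "fB \<in> carrier (ghom CB X Y n)" "fgmor F X Y n fB = f"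
proof -
  have "\<exists>a. a \<in> carrier (Hom CB (X i) (Y (i + n))) \<and> fmor F (X i) (Y (i + n)) a = f i" for i
  proof -
    have "f i \<in> fmor F (X i) (Y (i + n)) ` carrier (Hom CB (X i) (Y (i + n)))"
      using assms by (simp add: full_functor_def graded_object_def mem_ghom fgob_def)
    then show ?thesis by auto
  qed
  then obtain fB where "\<And>i. fB i \<in> carrier (Hom CB (X i) (Y (i + n)))"
    "\<And>i. fmor F (X i) (Y (i + n)) (fB i) = f i"
    by metis
  then show ?thesis using that[of fB] by (simp add: mem_ghom fgmor_def)
qed

lemma kernel_square_zero_gcomp:
  assumes "kernel_square_zero CB C F"
    and "graded_object CB X" "graded_object CB Y" "graded_object CB Z"
    and "f \<in> carrier (ghom CB X Y m)" "g \<in> carrier (ghom CB Y Z n)"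
    and "fgmor F X Y m f = \<one>\<^bsub>ghom C (fgob F X) (fgob F Y) m\<^esub>"
    and "fgmor F Y Z n g = \<one>\<^bsub>ghom C (fgob F Y) (fgob F Z) n\<^esub>"
  shows "gcomp CB X Y Z m n g f = \<one>\<^bsub>ghom CB X Z (m + n)\<^esub>"
  using assms
  by (simp add: kernel_square_zero_def mem_ghom ghom_one gcomp_def fgmor_def fgob_def
      graded_object_def fun_eq_iff add.assoc[symmetric])

lemma kernel_cochains_subgroup:
  assumes "graded_object CB X"
  shows "subgroup (carrier (kernel_cochains CB C F X n)) (ghom CB X X n)"
  using group_hom.subgroup_kernel[OF fgmor_group_hom[OF assms assms]]
  by (simp add: kernel_def kernel_cochains_def)

lemma kernel_cochains_square_zero_ideal:
  assumes sq: "kernel_square_zero CB C F" and X: "graded_object CB X"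
  shows "square_zero_ideal (ghom CB X X) (gcomp CB X X X) (gident CB X)
    (\<lambda>n. carrier (kernel_cochains CB C F X n))"
proof (rule square_zero_ideal.intro)
  note FX = fgob_object[OF X]
  have mem: "f \<in> carrier (kernel_cochains CB C F X n) \<longleftrightarrow> f \<in> carrier (ghom CB X X n) \<and>
      fgmor F X X n f = \<one>\<^bsub>ghom C (fgob F X) (fgob F X) n\<^esub>" for f n
    by (simp add: kernel_cochains_def)
  have Fcl: "fgmor F X X n f \<in> carrier (ghom C (fgob F X) (fgob F X) n)"
    if "f \<in> carrier (ghom CB X X n)" for f n
    using group_hom.hom_closed[OF fgmor_group_hom[OF X X] that] .
  show "gcomp CB X X X m n g f \<in> carrier (kernel_cochains CB C F X (m + n))"
    if "f \<in> carrier (kernel_cochains CB C F X m)" "g \<in> carrier (ghom CB X X n)" for f g m n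
    using that X FX Fcl
    by (simp add: mem CB.gcomp_closed fgmor_gcomp C.gcomp_one_right)
  show "gcomp CB X X X m n g f \<in> carrier (kernel_cochains CB C F X (m + n))"
    if "f \<in> carrier (ghom CB X X m)" "g \<in> carrier (kernel_cochains CB C F X n)" for f g m n
    using that X FX Fcl
    by (simp add: mem CB.gcomp_closed fgmor_gcomp C.gcomp_one_left)
  show "gcomp CB X X X m n g f = \<one>\<^bsub>ghom CB X X (m + n)\<^esub>"
    if "f \<in> carrier (kernel_cochains CB C F X m)" "g \<in> carrier (kernel_cochains CB C F X n)"
    for f g m n
    using that kernel_square_zero_gcomp[OF sq X X X] by (simp add: mem)
qed (use X CB.gcomp_hom_right CB.gcomp_hom_left CB.gcomp_assoc CB.gident_closed
    CB.gcomp_ident_left CB.gcomp_ident_right CB.ghom_comm_group kernel_cochains_subgroup in auto)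

end


section \<open>Lifts of a complex along the functor\<close>

context linear_functor
begin

lemma lift_object_simps:
  assumes "graded_object_lift CB C F X XB c"
  shows "graded_object CB XB" "graded_iso C X (fgob F XB) c" "c \<in> carrier (ghom C X (fgob F XB) 0)"
  using assms by (auto simp: graded_object_lift_def graded_iso_def)

text \<open>
  Transport \<open>f\<close> along \<open>c\<close> to the endomorphism \<open>c f c\<^sup>-\<^sup>1\<close> of \<open>F(XB)\<close> and use that \<open>F\<close> is full.
\<close>

lemma graded_map_lift_exists:
  assumes full: "full_functor CB C F" and X: "graded_object C X"
    and c: "graded_object_lift CB C F X XB c" and f: "f \<in> carrier (ghom C X X n)"
  obtains fB where "graded_map_lift CB C F X XB c X XB c n f fB"
proof -
  note XB = lift_object_simps(1)[OF c] and cc = lift_object_simps(3)[OF c]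
  note FX = fgob_object[OF XB]
  obtain b where b: "b \<in> carrier (ghom C (fgob F XB) X 0)" "gcomp C X (fgob F XB) X 0 0 b c = gident C X"
    using lift_object_simps(2)[OF c] by (auto simp: graded_iso_def)
  define cf where "cf = gcomp C X X (fgob F XB) n 0 c f"
  have cf: "cf \<in> carrier (ghom C X (fgob F XB) n)"
    using C.gcomp_closed[OF X X FX f cc] by (simp add: cf_def)
  define cfb where "cfb = gcomp C (fgob F XB) X (fgob F XB) 0 n cf b"
  have "cfb \<in> carrier (ghom C (fgob F XB) (fgob F XB) n)"
    using C.gcomp_closed[OF FX X FX b(1) cf] by (simp add: cfb_def)
  then obtain fB where fB: "fB \<in> carrier (ghom CB XB XB n)" "fgmor F XB XB n fB = cfb"
    using fgmor_full[OF full XB XB] by blast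
  have "gcomp C X (fgob F XB) (fgob F XB) 0 n cfb c = cf"
    using C.gcomp_assoc[OF X FX X FX cc b(1) cf] b(2) C.gcomp_ident_right[OF X FX cf]
    by (simp add: cfb_def)
  with fB that[of fB] show ?thesis by (simp add: graded_map_lift_def cf_def)
qed

text \<open>
  The condition \<open>F(gB) c = c f = F(fB) c\<close> determines \<open>F(gB)\<close>, since \<open>c\<close> is invertible.
\<close>

lemma graded_map_lift_iff:
  assumes X: "graded_object C X" and c: "graded_object_lift CB C F X XB c"
    and f: "graded_map_lift CB C F X XB c X XB c n f fB"
  shows "graded_map_lift CB C F X XB c X XB c n f gB \<longleftrightarrow>
    gB \<in> carrier (kernel_cochains CB C F XB n) #>\<^bsub>ghom CB XB XB n\<^esub> fB"
proof (cases "gB \<in> carrier (ghom CB XB XB n)")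
  case True
  note XB = lift_object_simps(1)[OF c]
  interpret F: group_hom "ghom CB XB XB n" "ghom C (fgob F XB) (fgob F XB) n" "fgmor F XB XB n"
    by (rule fgmor_group_hom[OF XB XB])
  have fB: "fB \<in> carrier (ghom CB XB XB n)" using f by (simp add: graded_map_lift_def)
  have "graded_map_lift CB C F X XB c X XB c n f gB \<longleftrightarrow>
      gcomp C X (fgob F XB) (fgob F XB) 0 n (fgmor F XB XB n gB) c =
      gcomp C X (fgob F XB) (fgob F XB) 0 n (fgmor F XB XB n fB) c"
    using f True by (simp add: graded_map_lift_def)
  also have "\<dots> \<longleftrightarrow> fgmor F XB XB n gB = fgmor F XB XB n fB"
    using C.graded_iso_cancel_right[OF X fgob_object[OF XB] fgob_object[OF XB]
        lift_object_simps(2)[OF c]] True fB by (metis F.hom_closed)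
  also have "\<dots> \<longleftrightarrow> gdiff (ghom CB XB XB n) gB fB \<in> carrier (kernel_cochains CB C F XB n)"
    using True fB gdiff_closed[OF F.G.is_group True fB]
      gdiff_eq_iff[OF F.H.is_group _ _ F.H.one_closed, of "fgmor F XB XB n gB" "fgmor F XB XB n fB"]
    by (simp add: kernel_cochains_def gdiff_def)
  also have "\<dots> \<longleftrightarrow> gB \<in> carrier (kernel_cochains CB C F XB n) #>\<^bsub>ghom CB XB XB n\<^esub> fB"
    using mem_rcoset_iff_gdiff[OF F.G.is_group kernel_cochains_subgroup[OF XB] fB True] by simp
  finally show ?thesis .
next
  case False
  note XB = lift_object_simps(1)[OF c]
  interpret G: comm_group "ghom CB XB XB n" by (rule CB.ghom_comm_group[OF XB XB])
  have "fB \<in> carrier (ghom CB XB XB n)" using f by (simp add: graded_map_lift_def)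
  then show ?thesis
    using False G.r_coset_subset_G[OF subgroup.subset[OF kernel_cochains_subgroup[OF XB]]]
    by (auto simp: graded_map_lift_def)
qed

lemma gident_lift:
  assumes X: "graded_object C X" and c: "graded_object_lift CB C F X XB c"
  shows "graded_map_lift CB C F X XB c X XB c 0 (gident C X) (gident CB XB)"
  using assms lift_object_simps[OF c] fgob_object
  by (simp add: graded_map_lift_def CB.gident_closed fgmor_gident C.gcomp_ident_left
      C.gcomp_ident_right)

text \<open>
  \<open>F(d\<^sub>0\<^sup>2) c = F(d\<^sub>0) c d = c d\<^sup>2 = 0\<close>, and \<open>c\<close> is invertible.
\<close>

lemma lift_square_kernel:
  assumes d: "cochain_complex C X d" and c: "graded_object_lift CB C F X XB c"
    and d0: "graded_map_lift CB C F X XB c X XB c 1 d d0"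
  shows "gcomp CB XB XB XB 1 1 d0 d0 \<in> carrier (kernel_cochains CB C F XB 2)"
proof -
  note XB = lift_object_simps(1)[OF c] and cc = lift_object_simps(3)[OF c]
  note FX = fgob_object[OF XB]
  have X: "graded_object C X" and dc: "d \<in> carrier (ghom C X X 1)"
    and dd: "gcomp C X X X 1 1 d d = \<one>\<^bsub>ghom C X X 2\<^esub>"
    using d by (auto simp: cochain_complex_def differential_def)
  have d0c: "d0 \<in> carrier (ghom CB XB XB 1)" using d0 by (simp add: graded_map_lift_def)
  define Fd where "Fd = fgmor F XB XB 1 d0"
  have Fd: "Fd \<in> carrier (ghom C (fgob F XB) (fgob F XB) 1)"
    unfolding Fd_def by (rule group_hom.hom_closed[OF fgmor_group_hom[OF XB XB] d0c])
  have Fdc: "gcomp C X (fgob F XB) (fgob F XB) 0 1 Fd c = gcomp C X X (fgob F XB) 1 0 c d"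
    using d0 by (simp add: graded_map_lift_def Fd_def)
  have "gcomp C X (fgob F XB) (fgob F XB) 0 2 (gcomp C (fgob F XB) (fgob F XB) (fgob F XB) 1 1 Fd Fd) c =
      gcomp C X (fgob F XB) (fgob F XB) 1 1 Fd (gcomp C X X (fgob F XB) 1 0 c d)"
    using C.gcomp_assoc[OF X FX FX FX cc Fd Fd] by (simp add: Fdc)
  also have "\<dots> = gcomp C X X (fgob F XB) 1 1 (gcomp C X X (fgob F XB) 1 0 c d) d"
    using C.gcomp_assoc[OF X X FX FX dc cc Fd] by (simp add: Fdc)
  also have "\<dots> = \<one>\<^bsub>ghom C X (fgob F XB) 2\<^esub>"
    using C.gcomp_assoc[OF X X X FX dc dc cc] C.gcomp_one_right[OF X X FX cc, of 2]
    by (simp add: dd)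
  also have "\<dots> = gcomp C X (fgob F XB) (fgob F XB) 0 2 \<one>\<^bsub>ghom C (fgob F XB) (fgob F XB) 2\<^esub> c"
    using C.gcomp_one_left[OF X FX FX cc, of 2] by simp
  finally have "gcomp C (fgob F XB) (fgob F XB) (fgob F XB) 1 1 Fd Fd = \<one>\<^bsub>ghom C (fgob F XB) (fgob F XB) 2\<^esub>"
    using C.graded_iso_cancel_right[OF X FX FX lift_object_simps(2)[OF c]]
      C.gcomp_closed[OF FX FX FX Fd Fd, of 2]
      monoid.one_closed[OF group.is_monoid[OF comm_group.axioms(2)[OF C.ghom_comm_group[OF FX FX]]]]
    by simp
  then show ?thesis
    using fgmor_gcomp[OF XB XB XB d0c d0c, of 2] CB.gcomp_closed[OF XB XB XB d0c d0c, of 2]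
    by (simp add: kernel_cochains_def Fd_def)
qed

end

theorem theorem3p8:
  fixes R :: "'r ring" and S :: "'s ring"
    and CB :: "('o1, 'r, 'm1) lincat" and C :: "('o2, 's, 'm2) lincat"
    and F :: "('o1, 'm1, 'o2, 'm2) functor_data"
    and X :: "int \<Rightarrow> 'o2" and d :: "int \<Rightarrow> 'm2"
    and XB :: "int \<Rightarrow> 'o1" and c :: "int \<Rightarrow> 'm2"
  assumes "linear_category R CB"
    and "linear_category S C"
    and "additive_functor CB C F"
    and "full_functor CB C F"
    and "kernel_square_zero CB C F"
    and "cochain_complex C X d"
    and "graded_object_lift CB C F X XB c"
  shows "(\<exists>d0. graded_map_lift CB C F X XB c X XB c 1 d d0) \<and>
    (\<forall>d0. graded_map_lift CB C F X XB c X XB c 1 d d0 \<longrightarrow>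
      (let K = kernel_cochains CB C F XB;
           D = gdelta CB XB d0 XB d0;
           H = cohomology K D;
           cls = cohomology_class K D;
           L = lift_objects CB C F X XB c d;
           L1 = lift_1cells CB C F X XB c;
           L2 = lift_2cells CB C F XB;
           v = (\<lambda>dB dB'. cls 1 (gdiff (ghom CB XB XB 1) dB' dB));
           w = (\<lambda>u u'. cls 0 (gdiff (ghom CB XB XB 0) u' u))
       in \<exists>ob \<in> carrier (H 2).
         (\<forall>dB. graded_map_lift CB C F X XB c X XB c 1 d dB \<longrightarrow>
            ob = cls 2 (gcomp CB XB XB XB 1 1 dB dB)) \<and>
         (ob = \<one>\<^bsub>H 2\<^esub> \<longleftrightarrow> L \<noteq> {}) \<and>
         (ob = \<one>\<^bsub>H 2\<^esub> \<longrightarrow>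
            (\<forall>dB\<in>L. \<forall>dB'\<in>L. v dB dB' \<in> carrier (H 1) \<and>
               (v dB dB' = \<one>\<^bsub>H 1\<^esub> \<longleftrightarrow> sk_class L L1 dB = sk_class L L1 dB')) \<and>
            induces_affine_structure (H 1) (Sk L L1) L (sk_class L L1) v) \<and>
         (\<forall>dB\<in>L. \<forall>dB'\<in>L. v dB dB' = \<one>\<^bsub>H 1\<^esub> \<longrightarrow>
            (\<forall>u\<in>L1 dB dB'. \<forall>u'\<in>L1 dB dB'. w u u' \<in> carrier (H 0) \<and>
               (w u u' = \<one>\<^bsub>H 0\<^esub> \<longleftrightarrow>
                  sk_class (L1 dB dB') (L2 dB dB') u = sk_class (L1 dB dB') (L2 dB dB') u')) \<and>
            induces_affine_structure (H 0) (Sk (L1 dB dB') (L2 dB dB'))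
              (L1 dB dB') (sk_class (L1 dB dB') (L2 dB dB')) w)))"
proof -
  interpret linear_functor R S CB C F
    using assms by (simp add: linear_functor_def)
  note c = assms(7)
  note XB = lift_object_simps(1)[OF c]
  have X: "graded_object C X" and dc: "d \<in> carrier (ghom C X X 1)"
    using assms(6) by (auto simp: cochain_complex_def differential_def)
  note lift_iff = graded_map_lift_iff[OF X c]
  show ?thesis
  proof (intro conjI allI impI, goal_cases)
    case 1
    show ?case
      using graded_map_lift_exists[OF assms(4) X c dc] by blast
  next
    case (2 d0)
    note d0 = \<open>graded_map_lift CB C F X XB c X XB c 1 d d0\<close>
    \<comment> \<open>Naming the ideal prevents the rewriting of \<open>kernel_cochains\<close> to \<open>E.K\<close>, which mentions the ideal,
      from applying to its own result.\<close>
    define J where "J n = carrier (kernel_cochains CB C F XB n)" for n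
    interpret E: lifted_differential "ghom CB XB XB" "gcomp CB XB XB XB" "gident CB XB" J d0
      using kernel_cochains_square_zero_ideal[OF assms(5) XB] lift_square_kernel[OF assms(6) c d0] d0
      by (simp add: lifted_differential_def lifted_differential_axioms_def graded_map_lift_def
          J_def[abs_def])
    have delta: "E.delta dB dB' n = gdelta CB XB dB XB dB' n" for dB dB' n
      by (simp add: fun_eq_iff gdelta_def E.delta_def)
    have K: "kernel_cochains CB C F XB = E.K"
      by (simp add: fun_eq_iff E.K_def J_def kernel_cochains_def)
    have D: "gdelta CB XB d0 XB d0 = E.D"
      by (simp add: fun_eq_iff E.D_def delta)
    have lifts: "graded_map_lift CB C F X XB c X XB c 1 d dB \<longleftrightarrow> dB \<in> E.lifts" for dB
      using lift_iff[OF d0] by (simp add: E.lifts_def J_def)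
    have one_lifts: "graded_map_lift CB C F X XB c X XB c 0 (gident C X) u \<longleftrightarrow> u \<in> E.one_lifts" for u
      using lift_iff[OF gident_lift[OF X c]] by (simp add: E.one_lifts_def J_def)
    have L: "lift_objects CB C F X XB c d = E.flat_lifts"
      by (auto simp: lift_objects_def lifts E.flat_lifts_def differential_def E.lift_closed)
    have L1: "lift_1cells CB C F X XB c dB dB' = E.intertwiners dB dB'"
      if "dB \<in> E.lifts" "dB' \<in> E.lifts" for dB dB'
    proof -
      have chain: "chain_map CB XB a XB b u" if "u \<in> E.intertwiners a b" for a b u
        using that by (simp add: chain_map_def E.intertwiners_def E.one_lift_closed)
      have "complex_iso CB XB dB XB dB' u" if u: "u \<in> E.intertwiners dB dB'" for u
        using E.intertwiner_invertible[OF \<open>dB \<in> E.lifts\<close> \<open>dB' \<in> E.lifts\<close> u] chain u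
        unfolding complex_iso_def by metis
      then show ?thesis
        by (auto simp: lift_1cells_def one_lifts E.intertwiners_def complex_iso_def chain_map_def)
    qed
    have L2: "lift_2cells CB C F XB dB dB' = E.homotopies dB dB'" for dB dB'
      by (simp add: fun_eq_iff[of _ "E.homotopies dB dB'"] fun_eq_iff[of _ "E.homotopies dB dB' _"]
          lift_2cells_def E.homotopies_def delta J_def kernel_cochains_def conj_assoc)
    have flat: "dB \<in> E.lifts" if "dB \<in> E.flat_lifts" for dB
      using that by (simp add: E.flat_lifts_def)
    \<comment> \<open>1-cells and intertwiners agree only between lifts, hence only as relations on the objects.\<close>
    have rel: "sk_rel E.flat_lifts (lift_1cells CB C F X XB c) = sk_rel E.flat_lifts E.intertwiners"
      by (rule sk_rel_cong) (simp add: L1 flat)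
    have sk_class: "sk_class E.flat_lifts (lift_1cells CB C F X XB c) =
        sk_class E.flat_lifts E.intertwiners"
      by (simp add: fun_eq_iff sk_class_def rel)
    have Sk: "Sk E.flat_lifts (lift_1cells CB C F X XB c) = Sk E.flat_lifts E.intertwiners"
      by (simp add: Sk_def rel)
    define ob where "ob = cohomology_class E.K E.D 2 (gcomp CB XB XB XB 1 1 d0 d0)"
    have ob: "ob \<in> carrier (cohomology E.K E.D 2)"
      using E.square_cocycle[OF E.d0_lift] E.cohomology_class_closed by (simp add: ob_def)
    have ob_indep: "ob = cohomology_class E.K E.D 2 (gcomp CB XB XB XB 1 1 dB dB)"
      if "dB \<in> E.lifts" for dB
      using E.square_class_indep[OF E.d0_lift that] by (simp add: ob_def)
    have ob_iff: "ob = \<one>\<^bsub>cohomology E.K E.D 2\<^esub> \<longleftrightarrow> E.flat_lifts \<noteq> {}"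
      unfolding ob_def by (rule E.obstruction_vanishes_iff)
    have nonempty: "E.intertwiners dB dB' \<noteq> {}"
      if "dB \<in> E.flat_lifts" "dB' \<in> E.flat_lifts"
        "cohomology_class E.K E.D 1 (gdiff (ghom CB XB XB 1) dB' dB) = \<one>\<^bsub>cohomology E.K E.D 1\<^esub>"
      for dB dB'
      using E.flat_lifts_torsor(3) that by blast
    show ?case
      unfolding Let_def K D L sk_class Sk L2
    proof (intro bexI[OF _ ob] conjI ballI allI impI, goal_cases)
      case (1 dB)
      then show ?case using ob_indep lifts by blast
    next
      case 2
      show ?case by (rule ob_iff)
    next
      case (3 dB dB')
      then show ?case using E.flat_lifts_torsor(1) ob_iff by simp
    next
      case (4 dB dB')
      then show ?case using E.flat_lifts_torsor(2) ob_iff by simp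
    next
      case 5
      then show ?case using E.flat_lifts_torsor(4) ob_iff by simp
    next
      case (6 dB dB' u u')
      note l = flat[OF 6(1)] flat[OF 6(2)]
      show ?case
        using 6(4,5) unfolding L1[OF l]
        by (rule E.intertwiners_torsor(1)[OF l nonempty[OF 6(1-3)]])
    next
      case (7 dB dB' u u')
      note l = flat[OF 7(1)] flat[OF 7(2)]
      show ?case
        using 7(4,5) unfolding L1[OF l]
        by (rule E.intertwiners_torsor(2)[OF l nonempty[OF 7(1-3)]])
    next
      case (8 dB dB')
      note l = flat[OF 8(1)] flat[OF 8(2)]
      show ?case
        unfolding L1[OF l] by (rule E.intertwiners_torsor(3)[OF l nonempty[OF 8]])
    qed
  qed
qed

end
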